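(* Let $m<n$ be positive integers and let $E$ be the $n\times m$ diagonal matrix whose diagonal entries are all $1$. Then $$\mu(\{E\})=\frac{1}{\prod_{i=n-m+1}^{n}\zeta(i)}.$$ As $n\to\infty$, this converges to $1$ if $m$ is fixed, and to $\dfrac{1}{\prod_{i=n-m+1}^{\infty}\zeta(i)}$ if $n-m$ is fixed.
   Context: $\zeta$ is the Riemann zeta function. For a positive integer $k$, $\mathbb{Z}_{(k)}=\{-k,\dots,k\}$. The Smith normal form (SNF) of an $n\times m$ integer matrix $M$ is the diagonal matrix $PMQ$ ($P,Q$ invertible over $\mathbb{Z}$) with nonnegative diagonal entries $d_1\mid d_2\mid\cdots\mid d_m$ (trailing entries may be $0$). For a set $\mathcal{S}$ of such diagonal matrices, $\mu^{(k)}(\mathcal{S})$ is the probability that $\mathrm{SNF}(M)\in\mathcal{S}$ for a random $n\times m$ matrix $M$ with independent entries uniform on $\mathbb{Z}_{(k)}$, and $\mu(\mathcal{S})=\lim_{k\to\infty}\mu^{(k)}(\mathcal{S})$ if the limit exists (its existence is part of the claim). *)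

theory Defs
  imports "HOL-Probability.Probability" "Jordan_Normal_Form.Matrix"
begin

text \<open>The Riemann zeta function on the half-line \<open>s > 1\<close>, given there by its Dirichlet series;
  outside the region of convergence the value is meaningless.\<close>

definition zeta :: "real \<Rightarrow> real" where
  "zeta s = (\<Sum>k. 1 / real (Suc k) powr s)"

text \<open>The Smith normal form over the integers.  It exists and is unique for every integer matrix,
  so it may be given as a relation between a matrix and its normal form.\<close>

definition smith_normal_form :: "int mat \<Rightarrow> int mat \<Rightarrow> bool" where
  "smith_normal_form M D \<longleftrightarrow>
     (\<exists>P \<in> carrier_mat (dim_row M) (dim_row M). \<exists>Q \<in> carrier_mat (dim_col M) (dim_col M).
        invertible_mat P \<and> invertible_mat Q \<and> D = P * M * Q) \<and>
     diagonal_mat D \<and>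
     (\<forall>i < min (dim_row D) (dim_col D). 0 \<le> D $$ (i, i)) \<and>
     (\<forall>i. Suc i < min (dim_row D) (dim_col D) \<longrightarrow> D $$ (i, i) dvd D $$ (Suc i, Suc i))"

text \<open>Independent entries, each uniform on \<open>{-k..k}\<close>.  The third argument of \<^const>\<open>Pi_pmf\<close> is
  only the value at positions outside the matrix and plays no role.\<close>

definition random_int_mat :: "nat \<Rightarrow> nat \<Rightarrow> nat \<Rightarrow> int mat pmf" where
  "random_int_mat n m k =
     map_pmf (Matrix.mat n m) (Pi_pmf ({..<n} \<times> {..<m}) 0 (\<lambda>_. pmf_of_set {- int k..int k}))"

definition snf_prob :: "nat \<Rightarrow> nat \<Rightarrow> nat \<Rightarrow> int mat set \<Rightarrow> real" where
  "snf_prob n m k S =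
     measure_pmf.prob (random_int_mat n m k) {M. \<exists>D\<in>S. smith_normal_form M D}"

text \<open>Meaningful only when the limit exists.\<close>

definition snf_density :: "nat \<Rightarrow> nat \<Rightarrow> int mat set \<Rightarrow> real" where
  "snf_density n m S = lim (\<lambda>k. snf_prob n m k S)"

definition diag_ones :: "nat \<Rightarrow> nat \<Rightarrow> int mat" where
  "diag_ones n m = Matrix.mat n m (\<lambda>(i, j). if i = j then 1 else 0)"

end

theory Submission
  imports Defs "Jordan_Normal_Form.Determinant" "HOL-Number_Theory.Cong" "HOL-Real_Asymp.Real_Asymp"
begin

text \<open>
  A matrix with more rows than columns has Smith normal form \<open>E\<close> exactly when its columns stay
  linearly independent modulo every prime (\<open>smith_diag_ones_iff\<close>): a unimodular change of
  coordinates turns a kernel vector modulo \<open>p\<close> into one of \<open>E\<close>, and conversely the columns of a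
  matrix of full rank modulo every prime can be turned into those of \<open>E\<close> one after the other by
  integral row operations.

  Modulo a single prime the number of full rank matrices is classical: each column has to avoid the
  span of the previous ones, which gives the probability
  \<open>\<Prod>j<m. 1 - p^j / p^n = \<Prod>i=n-m+1..n. 1 - p^(-i)\<close>.  For a fixed finite set of primes the
  box is equidistributed modulo their product as \<open>k\<close> grows, and by the Chinese remainder theorem
  the conditions at distinct primes are independent in the limit
  (\<open>prob_full_rank_finite_primes_tendsto\<close>).  Taking more and more primes, Euler's product yields
  \<open>\<Prod>i=n-m+1..n. 1 / zeta i\<close>.

  The analytic difficulty is the exchange of the two limits: the probability of being
  rank deficient modulo some prime above \<open>B\<close> has to be small uniformly in large \<open>k\<close>
  (\<open>large_primes_negligible\<close>).  Dropping rows makes deficiency more likely, so it suffices to treat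
  one row more than columns, by induction on the number of columns.  Primes \<open>p\<close> up to the number
  \<open>2k+1\<close> of possible entries contribute \<open>O(1/p^2)\<close> each, by the column count.  Larger primes are
  too many for a union bound, but they must divide the determinant of the square block on top;
  that determinant vanishes with probability tending to \<open>0\<close> and otherwise has boundedly many such
  prime divisors.  If the matrix without its last row and column has full rank modulo such a prime,
  then the kernel of the block is a line, determined before the last row is drawn, and the last row
  has to lie in a fixed hyperplane modulo \<open>p\<close>, which has probability at most \<open>1/(2k+1)\<close>.  The
  remaining case is the induction hypothesis.

  The two limits in \<open>n\<close> follow from the exponential decay of \<open>zeta i - 1\<close>.
\<close>

section \<open>Rank deficiency modulo a prime\<close>

text \<open>A linear dependence modulo \<open>p\<close> among the first \<open>m\<close> columns, restricted to the first \<open>n\<close> rows.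
  Matrices are functions on index pairs here, so that rows and columns can be dropped without
  changing the object.\<close>

definition rank_deficient :: "nat \<Rightarrow> nat \<Rightarrow> nat \<Rightarrow> (nat \<times> nat \<Rightarrow> int) \<Rightarrow> bool" where
  "rank_deficient p n m A \<longleftrightarrow>
     (\<exists>v. (\<exists>j<m. \<not> int p dvd v j) \<and> (\<forall>i<n. int p dvd (\<Sum>j<m. A (i, j) * v j)))"

lemma rank_deficientI:
  assumes "j < m" "\<not> int p dvd v j" "\<And>i. i < n \<Longrightarrow> int p dvd (\<Sum>j<m. A (i, j) * v j)"
  shows "rank_deficient p n m A"
  using assms unfolding rank_deficient_def by blast

lemma rank_deficient_cong:
  assumes "\<And>i j. i < n \<Longrightarrow> j < m \<Longrightarrow> [A (i, j) = B (i, j)] (mod int p)"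
  shows "rank_deficient p n m A \<longleftrightarrow> rank_deficient p n m B"
proof -
  have "[(\<Sum>j<m. A (i, j) * v j) = (\<Sum>j<m. B (i, j) * v j)] (mod int p)" if "i < n" for i v
    using assms that by (intro cong_sum cong_mult) auto
  then have "int p dvd (\<Sum>j<m. A (i, j) * v j) \<longleftrightarrow> int p dvd (\<Sum>j<m. B (i, j) * v j)" if "i < n" for i v
    using that by (intro cong_dvd_iff) auto
  then show ?thesis unfolding rank_deficient_def by (simp cong: conj_cong)
qed

text \<open>In a dependence involving the new column, the coefficient of that column is invertible
  modulo \<open>p\<close> and can be normalised away.  Reducing the others to representatives leaves only
  \<open>p ^ m\<close> combinations, over which a union bound or an exact count is possible.\<close>

lemma rank_deficient_Suc:
  assumes p: "prime p"
  shows "rank_deficient p n (Suc m) A \<longleftrightarrow> rank_deficient p n m A \<or>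
    (\<exists>v\<in>{..<m} \<rightarrow>\<^sub>E {0..<int p}. \<forall>i<n. [A (i, m) = (\<Sum>j<m. A (i, j) * v j)] (mod int p))"
    (is "?L \<longleftrightarrow> ?R1 \<or> ?R2")
proof
  assume ?L
  then obtain v where v: "\<exists>j<Suc m. \<not> int p dvd v j"
    "\<And>i. i < n \<Longrightarrow> int p dvd (\<Sum>j<m. A (i, j) * v j) + A (i, m) * v m"
    unfolding rank_deficient_def by auto
  show "?R1 \<or> ?R2"
  proof (cases "int p dvd v m")
    case True
    then have "\<exists>j<m. \<not> int p dvd v j" using v(1) by (auto simp: less_Suc_eq)
    moreover have "int p dvd (\<Sum>j<m. A (i, j) * v j)" if "i < n" for i
      using v(2)[OF that] True by (simp add: dvd_add_left_iff)
    ultimately have ?R1 unfolding rank_deficient_def by blast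
    then show ?thesis ..
  next
    case False
    then have "coprime (v m) (int p)"
      using p by (metis coprime_commute prime_imp_coprime prime_nat_int_transfer)
    then obtain u where u: "[v m * u = 1] (mod int p)" using cong_solve_coprime_int by blast
    define w where "w = restrict (\<lambda>j. (- v j * u) mod int p) {..<m}"
    have p0: "int p > 0" using p by (simp add: prime_gt_0_nat)
    have w: "w \<in> {..<m} \<rightarrow>\<^sub>E {0..<int p}" unfolding w_def using p0 by auto
    have "[A (i, m) = (\<Sum>j<m. A (i, j) * w j)] (mod int p)" if i: "i < n" for i
    proof -
      have "[(\<Sum>j<m. A (i, j) * w j) = (\<Sum>j<m. A (i, j) * (- v j * u))] (mod int p)"
        by (intro cong_sum cong_mult) (auto simp: w_def cong_def)
      also have "(\<Sum>j<m. A (i, j) * (- v j * u)) = A (i, m) * v m * u -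
          ((\<Sum>j<m. A (i, j) * v j) + A (i, m) * v m) * u"
        by (simp add: sum_distrib_left algebra_simps sum_negf)
      also have "[\<dots> = A (i, m) * v m * u - 0] (mod int p)"
        using v(2)[OF i] by (intro cong_diff cong_refl) (simp add: cong_0_iff)
      also have "A (i, m) * v m * u - 0 = A (i, m) * (v m * u)" by simp
      also have "[\<dots> = A (i, m) * 1] (mod int p)" by (intro cong_mult cong_refl u)
      finally show ?thesis by (simp add: cong_sym)
    qed
    with w have ?R2 by blast
    then show ?thesis ..
  qed
next
  assume "?R1 \<or> ?R2"
  then show ?L
  proof
    assume ?R1
    then obtain v where v: "\<exists>j<m. \<not> int p dvd v j" "\<And>i. i < n \<Longrightarrow> int p dvd (\<Sum>j<m. A (i, j) * v j)"
      unfolding rank_deficient_def by blast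
    then obtain j where j: "j < m" "\<not> int p dvd v j" by blast
    show ?L unfolding rank_deficient_def
    proof (intro exI[of _ "v(m := 0)"] conjI)
      show "\<exists>j<Suc m. \<not> int p dvd (v(m := 0)) j" using j by (intro exI[of _ j]) auto
    qed (use v(2) in auto)
  next
    assume ?R2
    then obtain v where v: "\<And>i. i < n \<Longrightarrow> [A (i, m) = (\<Sum>j<m. A (i, j) * v j)] (mod int p)" by blast
    have "int p dvd (\<Sum>j<Suc m. A (i, j) * (v(m := - 1)) j)" if "i < n" for i
      using v[OF that] by (simp add: cong_iff_dvd_diff dvd_diff_commute)
    moreover have "\<not> int p dvd (v(m := - 1)) m" using p by auto
    ultimately show ?L unfolding rank_deficient_def by blast
  qed
qed

lemma rank_deficient_fewer_rows:
  assumes "rank_deficient p n m A" "n' \<le> n"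
  shows "rank_deficient p n' m A"
  using assms unfolding rank_deficient_def by (meson order_less_le_trans)

lemma rank_deficient_mod:
  assumes "p dvd N"
  shows "rank_deficient p n m (\<lambda>x. A x mod int N) \<longleftrightarrow> rank_deficient p n m A"
proof (rule rank_deficient_cong)
  have "int p dvd int N" using assms by simp
  then show "[A (i, j) mod int N = A (i, j)] (mod int p)" for i j by (simp add: cong_def mod_mod_cancel)
qed

section \<open>Smith normal form and rank modulo all primes\<close>

text \<open>Adding multiples of one row to another is the only elementary operation needed: it generates
  row swaps up to sign, and the matrices under consideration have a spare row to fix signs.\<close>

definition add_row :: "int \<Rightarrow> nat \<Rightarrow> nat \<Rightarrow> (nat \<times> nat \<Rightarrow> int) \<Rightarrow> nat \<times> nat \<Rightarrow> int" where
  "add_row a k l A = (\<lambda>(i, j). if i = k then A (k, j) + a * A (l, j) else A (i, j))"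

inductive row_equiv :: "nat \<Rightarrow> (nat \<times> nat \<Rightarrow> int) \<Rightarrow> (nat \<times> nat \<Rightarrow> int) \<Rightarrow> bool"
  for n A where
  same: "row_equiv n A A"
| step: "row_equiv n A B \<Longrightarrow> k < n \<Longrightarrow> l < n \<Longrightarrow> k \<noteq> l \<Longrightarrow> row_equiv n A (add_row a k l B)"

lemma row_equiv_trans:
  assumes "row_equiv n B C" "row_equiv n A B" shows "row_equiv n A C"
  using assms by (induction rule: row_equiv.induct) (auto intro: row_equiv.step)

text \<open>A kernel vector modulo \<open>p\<close> is not moved by row operations, since these act from the left.\<close>

lemma row_equiv_deficient:
  assumes "row_equiv n A B" "rank_deficient p n m B"
  shows "rank_deficient p n m A"
  using assms
proof (induction rule: row_equiv.induct)
  case (step B k l a)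
  from step.prems obtain v where v: "\<exists>j<m. \<not> int p dvd v j"
    "\<And>i. i < n \<Longrightarrow> int p dvd (\<Sum>j<m. add_row a k l B (i, j) * v j)"
    unfolding rank_deficient_def by blast
  have l: "int p dvd (\<Sum>j<m. B (l, j) * v j)"
    using v(2)[of l] step.hyps by (simp add: add_row_def)
  have "int p dvd (\<Sum>j<m. B (i, j) * v j)" if "i < n" for i
  proof (cases "i = k")
    case True
    have "(\<Sum>j<m. add_row a k l B (k, j) * v j) =
        (\<Sum>j<m. B (k, j) * v j) + a * (\<Sum>j<m. B (l, j) * v j)"
      by (simp add: add_row_def sum.distrib sum_distrib_left algebra_simps)
    moreover have "int p dvd a * (\<Sum>j<m. B (l, j) * v j)" using l by (rule dvd_mult)
    moreover have "int p dvd (\<Sum>j<m. add_row a k l B (k, j) * v j)"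
      using v(2) step.hyps by blast
    ultimately show ?thesis using True by (simp add: dvd_add_left_iff)
  next
    case False
    with v(2)[OF that] show ?thesis by (simp add: add_row_def)
  qed
  with v(1) have "rank_deficient p n m B" unfolding rank_deficient_def by blast
  then show ?case by (rule step.IH)
qed

lemma row_equiv_matrix:
  assumes "row_equiv n A B"
  shows "\<exists>P\<in>carrier_mat n n. invertible_mat P \<and> Matrix.mat n m B = P * Matrix.mat n m A"
  using assms
proof (induction rule: row_equiv.induct)
  case same
  show ?case
    by (intro bexI[of _ "1\<^sub>m n"]) (auto simp: invertible_mat_def inverts_mat_def intro!: exI[of _ "1\<^sub>m n"])
next
  case (step B k l a)
  then obtain P P' where P: "P \<in> carrier_mat n n" "Matrix.mat n m B = P * Matrix.mat n m A"
    "inverts_mat P P'" "inverts_mat P' P" unfolding invertible_mat_def by blast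
  have P': "P' \<in> carrier_mat n n"
    using P by (metis (no_types, lifting) carrier_matD(1,2) carrier_matI index_mult_mat(2,3)
        index_one_mat(2,3) inverts_mat_def)
  let ?E = "addrow_mat n a k l" and ?F = "addrow_mat n (- a) k l"
  have EF: "?E * ?F = 1\<^sub>m n" "?F * ?E = 1\<^sub>m n"
    using addrow_mat_inv[OF step.hyps(2-4), of a] addrow_mat_inv[OF step.hyps(2-4), of "- a"]
    by simp_all
  have PP: "P * P' = 1\<^sub>m n" "P' * P = 1\<^sub>m n" using P P' by (auto simp: inverts_mat_def)
  have c: "?E \<in> carrier_mat n n" "?F \<in> carrier_mat n n" by auto
  have "(?E * P) * (P' * ?F) = ?E * (P * P') * ?F"
    using assoc_mult_mat[of ?E n n P n "P' * ?F" n] assoc_mult_mat[of P n n P' n ?F n]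
      assoc_mult_mat[of ?E n n "P * P'" n ?F n] P(1) P' c by simp
  hence 1: "(?E * P) * (P' * ?F) = 1\<^sub>m n" using PP EF c by simp
  have "(P' * ?F) * (?E * P) = P' * (?F * ?E) * P"
    using assoc_mult_mat[of P' n n ?F n "?E * P" n] assoc_mult_mat[of ?F n n ?E n P n]
      assoc_mult_mat[of P' n n "?F * ?E" n P n] P(1) P' c by simp
  hence 2: "(P' * ?F) * (?E * P) = 1\<^sub>m n" using PP EF c P' by simp
  have inv: "invertible_mat (?E * P)"
    unfolding invertible_mat_def inverts_mat_def
    using 1 2 P(1) P' by (auto intro!: exI[of _ "P' * ?F"])
  have "Matrix.mat n m (add_row a k l B) = addrow a k l (Matrix.mat n m B)"
    using step.hyps by (auto intro!: eq_matI simp: add_row_def)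
  also have "\<dots> = ?E * Matrix.mat n m B"
    by (rule addrow_mat) (use step.hyps in auto)
  also have "\<dots> = (?E * P) * Matrix.mat n m A"
    using P by (simp add: assoc_mult_mat[of _ n n _ n _ m])
  finally show ?case using inv P(1) by (intro bexI[of _ "?E * P"]) auto
qed

text \<open>The Euclidean algorithm on the entries of column \<open>c\<close> in rows \<open>j..<n\<close>: as long as two of them are
  nonzero, the sum of absolute values can be decreased.  At the end a single nonzero entry is left,
  and it is a unit because no prime divides all entries.  The earlier columns do not change, as
  the rows involved vanish there.\<close>

lemma row_equiv_unit_entry:
  fixes A :: "nat \<times> nat \<Rightarrow> int"
  assumes "\<And>p. prime p \<Longrightarrow> \<exists>i. j \<le> i \<and> i < n \<and> \<not> int p dvd A (i, c)"
    and "\<And>i d. j \<le> i \<Longrightarrow> i < n \<Longrightarrow> d < c \<Longrightarrow> A (i, d) = 0"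
  shows "\<exists>B i. row_equiv n A B \<and> j \<le> i \<and> i < n \<and> \<bar>B (i, c)\<bar> = 1 \<and>
    (\<forall>d<c. \<forall>i. B (i, d) = A (i, d))"
  using assms
proof (induction "\<Sum>i\<in>{j..<n}. nat \<bar>A (i, c)\<bar>" arbitrary: A rule: less_induct)
  case less
  show ?case
  proof (cases "\<exists>k l. j \<le> k \<and> k < n \<and> j \<le> l \<and> l < n \<and> k \<noteq> l \<and> A (k, c) \<noteq> 0 \<and> A (l, c) \<noteq> 0")
    case True
    then obtain k l where kl: "j \<le> k" "k < n" "j \<le> l" "l < n" "k \<noteq> l" "A (l, c) \<noteq> 0"
      "A (k, c) \<noteq> 0" "\<bar>A (l, c)\<bar> \<le> \<bar>A (k, c)\<bar>"
      by (metis linorder_linear)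
    \<comment> \<open>Subtracting the smaller entry once, with the sign that reduces the absolute value, is enough
      for termination.\<close>
    define a where "a = - sgn (A (k, c)) * sgn (A (l, c))"
    define A' where "A' = add_row a k l A"
    have small: "\<bar>A' (k, c)\<bar> < \<bar>A (k, c)\<bar>"
      using kl unfolding A'_def a_def add_row_def
      by (auto simp: sgn_if abs_if split: if_splits)
    have other: "A' (i, d) = A (i, d)" if "i \<noteq> k" for i d using that by (simp add: A'_def add_row_def)
    have re: "row_equiv n A A'" unfolding A'_def using kl by (intro row_equiv.intros) auto
    have dec: "(\<Sum>i\<in>{j..<n}. nat \<bar>A' (i, c)\<bar>) < (\<Sum>i\<in>{j..<n}. nat \<bar>A (i, c)\<bar>)"
    proof (rule sum_strict_mono_strong[of _ k])
      show "nat \<bar>A' (i, c)\<bar> \<le> nat \<bar>A (i, c)\<bar>" for i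
        using small other[of i c] by (cases "i = k") auto
    qed (use kl small in auto)
    have left: "A' (i, d) = A (i, d)" if "d < c" for i d
      using that less.prems(2)[of l d] kl by (simp add: A'_def add_row_def)
    have "\<exists>B i. row_equiv n A' B \<and> j \<le> i \<and> i < n \<and> \<bar>B (i, c)\<bar> = 1 \<and>
       (\<forall>d<c. \<forall>i. B (i, d) = A' (i, d))"
    proof (rule less.hyps[OF dec])
      fix p :: nat assume p: "prime p"
      show "\<exists>i. j \<le> i \<and> i < n \<and> \<not> int p dvd A' (i, c)"
      proof (rule ccontr)
        assume "\<not> ?thesis"
        hence *: "int p dvd A' (i, c)" if "j \<le> i" "i < n" for i using that by blast
        have l: "int p dvd A (l, c)" using *[of l] kl other[of l c] by auto
        have "int p dvd A (k, c)"
          using *[of k] kl l by (simp add: A'_def add_row_def dvd_add_left_iff)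
        hence "int p dvd A (i, c)" if "j \<le> i" "i < n" for i
          using *[OF that] other[of i c] by (cases "i = k") auto
        with less.prems(1)[OF p] show False by blast
      qed
    qed (use less.prems(2) left in auto)
    with left show ?thesis using row_equiv_trans[OF _ re] by auto
  next
    case False
    obtain i where i: "j \<le> i" "i < n" "A (i, c) \<noteq> 0"
      using less.prems(1)[of 2] by (metis dvd_0_right two_is_prime_nat)
    with False have z: "A (i', c) = 0" if "j \<le> i'" "i' < n" "i' \<noteq> i" for i' using that by blast
    have "\<bar>A (i, c)\<bar> = 1"
    proof (rule ccontr)
      assume "\<bar>A (i, c)\<bar> \<noteq> 1"
      hence "nat \<bar>A (i, c)\<bar> \<noteq> 1" by auto
      then obtain p where p: "prime p" "p dvd nat \<bar>A (i, c)\<bar>" using prime_factor_nat by blast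
      hence "int p dvd A (i, c)" by (simp add: int_dvd_int_iff[symmetric])
      with less.prems(1)[OF p(1)] z show False by (metis dvd_0_right)
    qed
    with i show ?thesis by (intro exI[of _ A] exI[of _ i]) (auto intro: row_equiv.same)
  qed
qed

text \<open>From a unit in some other row, any value can be produced in row \<open>j\<close>, in particular \<open>1\<close>.
  The spare row \<open>Suc j\<close> serves when the only available unit, possibly \<open>-1\<close>, sits in row \<open>j\<close>.\<close>

lemma row_equiv_pivot:
  fixes A :: "nat \<times> nat \<Rightarrow> int"
  assumes "Suc j < n"
    and "\<And>p. prime p \<Longrightarrow> \<exists>i. j \<le> i \<and> i < n \<and> \<not> int p dvd A (i, j)"
    and "\<And>i d. j \<le> i \<Longrightarrow> i < n \<Longrightarrow> d < j \<Longrightarrow> A (i, d) = 0"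
  shows "\<exists>B. row_equiv n A B \<and> B (j, j) = 1 \<and> (\<forall>d<j. \<forall>i. B (i, d) = A (i, d))"
proof -
  obtain B i where B: "row_equiv n A B" "j \<le> i" "i < n" "\<bar>B (i, j)\<bar> = 1"
    "\<And>d i. d < j \<Longrightarrow> B (i, d) = A (i, d)"
    using row_equiv_unit_entry[of j n A j] assms by blast
  have "\<exists>C i. row_equiv n A C \<and> j \<le> i \<and> i < n \<and> i \<noteq> j \<and> \<bar>C (i, j)\<bar> = 1 \<and>
     (\<forall>d<j. \<forall>i. C (i, d) = A (i, d))"
  proof (cases "i = j")
    case True
    define C where "C = add_row (B (j, j) * (1 - B (Suc j, j))) (Suc j) j B"
    have "B (j, j) * B (j, j) = 1" using B True by (metis abs_mult_self_eq mult_1)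
    hence "C (Suc j, j) = 1" by (simp add: C_def add_row_def algebra_simps)
    moreover have "C (i, d) = A (i, d)" if "d < j" for i d
      using B(5) assms that by (auto simp: C_def add_row_def)
    moreover have "row_equiv n A C" unfolding C_def using B assms by (intro row_equiv.step) auto
    ultimately show ?thesis using assms(1) by (intro exI[of _ C] exI[of _ "Suc j"]) auto
  qed (use B in blast)
  then obtain C i where C: "row_equiv n A C" "j \<le> i" "i < n" "i \<noteq> j" "\<bar>C (i, j)\<bar> = 1"
    "\<And>d i. d < j \<Longrightarrow> C (i, d) = A (i, d)" by blast
  define D where "D = add_row (C (i, j) * (1 - C (j, j))) j i C"
  have "C (i, j) * C (i, j) = 1" using C by (metis abs_mult_self_eq mult_1)
  hence "D (j, j) = 1" by (simp add: D_def add_row_def algebra_simps)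
  moreover have "D (i', d) = A (i', d)" if "d < j" for i' d
    using C assms(3) that by (auto simp: D_def add_row_def)
  moreover have "row_equiv n A D" unfolding D_def using C assms by (intro row_equiv.step) auto
  ultimately show ?thesis by blast
qed

lemma row_equiv_clear:
  fixes A :: "nat \<times> nat \<Rightarrow> int"
  assumes "j < n" "A (j, j) = 1" "\<And>d. d < j \<Longrightarrow> A (j, d) = 0" "finite I" "I \<subseteq> {..<n} - {j}"
  shows "\<exists>B. row_equiv n A B \<and> B (j, j) = 1 \<and> (\<forall>d<j. \<forall>i. B (i, d) = A (i, d)) \<and>
    (\<forall>i\<in>I. B (i, j) = 0)"
  using assms(4,5)
proof (induction I rule: finite_induct)
  case empty
  show ?case using assms by (intro exI[of _ A]) (auto intro: row_equiv.same)
next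
  case (insert i I)
  then obtain B where B: "row_equiv n A B" "B (j, j) = 1" "\<And>d i. d < j \<Longrightarrow> B (i, d) = A (i, d)"
    "\<forall>i\<in>I. B (i, j) = 0" by auto
  have "row_equiv n A (add_row (- B (i, j)) i j B)"
    using insert.prems assms(1) by (intro row_equiv.step B(1)) auto
  moreover have "i \<noteq> j" using insert.prems by auto
  ultimately show ?case
    using B assms by (intro exI[of _ "add_row (- B (i, j)) i j B"]) (auto simp: add_row_def)
qed

text \<open>Once the first \<open>c\<close> columns are unit vectors, the entries of column \<open>c\<close> below the first \<open>c\<close> rows
  have no common prime factor: otherwise subtracting the suitable combination of the earlier
  columns would give a dependence modulo that prime.  So the next pivot can be created.\<close>

lemma row_equiv_diag_ones:
  fixes A :: "nat \<times> nat \<Rightarrow> int"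
  assumes "m < n" "\<And>p. prime p \<Longrightarrow> \<not> rank_deficient p n m A" "c \<le> m"
  shows "\<exists>B. row_equiv n A B \<and> (\<forall>i<n. \<forall>d<c. B (i, d) = (if i = d then 1 else 0))"
  using assms(3)
proof (induction c)
  case 0
  show ?case by (auto intro: row_equiv.same)
next
  case (Suc c)
  then obtain B where B: "row_equiv n A B" "\<And>i d. i < n \<Longrightarrow> d < c \<Longrightarrow> B (i, d) = (if i = d then 1 else 0)"
    by auto
  have prim: "\<exists>i. c \<le> i \<and> i < n \<and> \<not> int p dvd B (i, c)" if p: "prime p" for p :: nat
  proof (rule ccontr)
    assume "\<not> ?thesis"
    hence *: "int p dvd B (i, c)" if "c \<le> i" "i < n" for i using that by blast
    \<comment> \<open>Column \<open>c\<close> minus the combination of the earlier unit columns that cancels its upper part.\<close>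
    define v where "v j = (if j = c then 1 else if j < c then - B (j, c) else 0)" for j
    have "(\<Sum>j<m. B (i, j) * v j) = (if c \<le> i then B (i, c) else 0)" if "i < n" for i
    proof -
      have "(\<Sum>j<m. B (i, j) * v j) = (\<Sum>j<Suc c. B (i, j) * v j)"
        using Suc.prems by (intro sum.mono_neutral_right) (auto simp: v_def)
      also have "\<dots> = (\<Sum>j<c. if i = j then - B (j, c) else 0) + B (i, c)"
      proof -
        have "(\<Sum>j<c. B (i, j) * v j) = (\<Sum>j<c. if i = j then - B (j, c) else 0)"
          using B(2) that by (intro sum.cong) (auto simp: v_def)
        then show ?thesis by (simp add: v_def)
      qed
      also have "(\<Sum>j<c. if i = j then - B (j, c) else 0) = (if i < c then - B (i, c) else 0)"
        by (simp add: sum.delta)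
      finally show ?thesis by auto
    qed
    hence "\<forall>i<n. int p dvd (\<Sum>j<m. B (i, j) * v j)" using * by auto
    moreover have "\<exists>j<m. \<not> int p dvd v j"
      using Suc.prems p by (intro exI[of _ c]) (auto simp: v_def)
    ultimately have "rank_deficient p n m B" unfolding rank_deficient_def by blast
    with row_equiv_deficient[OF B(1)] assms(2)[OF p] show False by blast
  qed
  obtain C where C: "row_equiv n B C" "C (c, c) = 1" "\<And>d i. d < c \<Longrightarrow> C (i, d) = B (i, d)"
    using row_equiv_pivot[of c n B] prim B(2) assms(1) Suc.prems by auto
  obtain D where D: "row_equiv n C D" "D (c, c) = 1" "\<And>d i. d < c \<Longrightarrow> D (i, d) = C (i, d)"
    "\<And>i. i < n \<Longrightarrow> i \<noteq> c \<Longrightarrow> D (i, c) = 0"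
    using row_equiv_clear[of c n C "{..<n} - {c}"] C B(2) assms(1) Suc.prems by auto
  have "row_equiv n A D" using row_equiv_trans[OF D(1) row_equiv_trans[OF C(1) B(1)]] .
  moreover have "D (i, d) = (if i = d then 1 else 0)" if "i < n" "d < Suc c" for i d
    using that B C D by (auto simp: less_Suc_eq)
  ultimately show ?case by blast
qed

text \<open>If \<open>E = P * M * Q\<close> and \<open>M x\<close> vanishes modulo \<open>p\<close>, then so does \<open>E\<close> applied to the vector
  \<open>w\<close> with \<open>x = Q w\<close>; but the first \<open>m\<close> entries of \<open>E w\<close> are those of \<open>w\<close>.\<close>

lemma smith_diag_ones_imp_full_rank:
  assumes snf: "smith_normal_form (Matrix.mat n m A) (diag_ones n m)" and mn: "m < n" and p: "prime p"
  shows "\<not> rank_deficient p n m A"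
proof
  assume "rank_deficient p n m A"
  then obtain v where v: "\<exists>j<m. \<not> int p dvd v j" "\<And>i. i < n \<Longrightarrow> int p dvd (\<Sum>j<m. A (i, j) * v j)"
    unfolding rank_deficient_def by blast
  let ?M = "Matrix.mat n m A"
  from snf obtain P Q where P: "P \<in> carrier_mat n n" and Q: "Q \<in> carrier_mat m m"
    and iQ: "invertible_mat Q" and D: "diag_ones n m = P * ?M * Q"
    unfolding smith_normal_form_def by auto
  from iQ obtain Q' where Q': "inverts_mat Q Q'" "inverts_mat Q' Q" unfolding invertible_mat_def by blast
  have cQ': "Q' \<in> carrier_mat m m"
    using Q Q' by (metis (no_types, lifting) carrier_matD(1,2) carrier_matI index_mult_mat(2,3)
        index_one_mat(2,3) inverts_mat_def)
  have QQ': "Q * Q' = 1\<^sub>m m" using Q Q' by (auto simp: inverts_mat_def)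
  define x where "x = Matrix.vec m v"
  have x: "x \<in> carrier_vec m" by (simp add: x_def)
  define w where "w = Q' *\<^sub>v x"
  have w: "w \<in> carrier_vec m" using cQ' x by (simp add: w_def)
  have M: "?M \<in> carrier_mat n m" by simp
  have "diag_ones n m *\<^sub>v w = P * ?M *\<^sub>v (Q *\<^sub>v w)"
    unfolding D using P M Q w by (meson assoc_mult_mat_vec mult_carrier_mat)
  also have "Q *\<^sub>v w = Q * Q' *\<^sub>v x"
    unfolding w_def using Q cQ' x by (metis assoc_mult_mat_vec)
  also have "\<dots> = x" using QQ' x by simp
  also have "P * ?M *\<^sub>v x = P *\<^sub>v (?M *\<^sub>v x)" using P M x by (metis assoc_mult_mat_vec)
  finally have eq: "diag_ones n m *\<^sub>v w = P *\<^sub>v (?M *\<^sub>v x)" .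
  have Mx: "int p dvd vec_index (?M *\<^sub>v x) i" if "i < n" for i
    using v(2)[OF that] that by (simp add: x_def scalar_prod_def lessThan_atLeast0)
  have pw: "int p dvd vec_index w i" if "i < m" for i
  proof -
    have "vec_index (diag_ones n m *\<^sub>v w) i = (\<Sum>j<m. (if i = j then 1 else 0) * vec_index w j)"
      using that mn w by (simp add: diag_ones_def scalar_prod_def lessThan_atLeast0)
    also have "\<dots> = vec_index w i" using that by (simp add: if_distrib[of "\<lambda>x. x * _"] cong: if_cong)
    finally have "vec_index w i = vec_index (P *\<^sub>v (?M *\<^sub>v x)) i" using eq by simp
    also have "\<dots> = (\<Sum>j<n. P $$ (i, j) * vec_index (?M *\<^sub>v x) j)"
      using that mn P by (simp add: scalar_prod_def lessThan_atLeast0)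
    also have "int p dvd \<dots>" using Mx by (intro dvd_sum dvd_mult) auto
    finally show ?thesis .
  qed
  have "int p dvd v j" if "j < m" for j
  proof -
    have "v j = vec_index (Q *\<^sub>v w) j"
      using that \<open>Q *\<^sub>v w = Q * Q' *\<^sub>v x\<close> \<open>Q * Q' *\<^sub>v x = x\<close> by (simp add: x_def)
    also have "\<dots> = (\<Sum>i<m. Q $$ (j, i) * vec_index w i)"
      using that Q w by (simp add: scalar_prod_def lessThan_atLeast0)
    also have "int p dvd \<dots>" using pw by (intro dvd_sum dvd_mult) auto
    finally show ?thesis .
  qed
  with v(1) show False by blast
qed

lemma smith_diag_ones_iff:
  assumes "m < n"
  shows "smith_normal_form (Matrix.mat n m A) (diag_ones n m) \<longleftrightarrow> (\<forall>p. prime p \<longrightarrow> \<not> rank_deficient p n m A)"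
proof
  assume "\<forall>p. prime p \<longrightarrow> \<not> rank_deficient p n m A"
  then obtain B where B: "row_equiv n A B" "\<And>i d. i < n \<Longrightarrow> d < m \<Longrightarrow> B (i, d) = (if i = d then 1 else 0)"
    using row_equiv_diag_ones[OF assms, of A m] by auto
  have "Matrix.mat n m B = diag_ones n m" using B(2) by (auto simp: diag_ones_def intro!: eq_matI)
  with row_equiv_matrix[OF B(1), of m] obtain P where P: "P \<in> carrier_mat n n" "invertible_mat P"
    "diag_ones n m = P * Matrix.mat n m A" by auto
  have "\<exists>P\<in>carrier_mat n n. \<exists>Q\<in>carrier_mat m m.
      invertible_mat P \<and> invertible_mat Q \<and> diag_ones n m = P * Matrix.mat n m A * Q"
    using P by (intro bexI[of _ P] bexI[of _ "1\<^sub>m m"])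
      (auto simp: invertible_mat_def inverts_mat_def intro!: exI[of _ "1\<^sub>m m"])
  then show "smith_normal_form (Matrix.mat n m A) (diag_ones n m)"
    unfolding smith_normal_form_def by (auto simp: diag_ones_def diagonal_mat_def)
qed (use smith_diag_ones_imp_full_rank[OF _ assms] in blast)

section \<open>Matrices with independent entries\<close>

abbreviation iid :: "(nat \<times> nat) set \<Rightarrow> int pmf \<Rightarrow> (nat \<times> nat \<Rightarrow> int) pmf" where
  "iid I b \<equiv> Pi_pmf I 0 (\<lambda>_. b)"

abbreviation merge :: "(nat \<times> nat) set \<Rightarrow> (nat \<times> nat \<Rightarrow> int) \<Rightarrow> (nat \<times> nat \<Rightarrow> int) \<Rightarrow> nat \<times> nat \<Rightarrow> int" where
  "merge I f g \<equiv> (\<lambda>x. if x \<in> I then f x else g x)"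

lemma prob_bind_pmf:
  "measure_pmf.prob (bind_pmf p h) X = measure_pmf.expectation p (\<lambda>x. measure_pmf.prob (h x) X)"
  unfolding measure_pmf_bind
  by (rule measure_pmf.measure_bind[where N = "count_space UNIV"])
     (auto simp: measure_subprob intro!: measurable_pair_swap')

text \<open>Conditioning on the entries at the positions \<open>I\<close>.\<close>

lemma prob_iid_Un:
  assumes "finite I" "finite J" "I \<inter> J = {}"
  shows "measure_pmf.prob (iid (I \<union> J) b) E =
    measure_pmf.expectation (iid I b) (\<lambda>f. measure_pmf.prob (iid J b) {g. merge I f g \<in> E})"
proof -
  have "iid (I \<union> J) b = bind_pmf (iid I b) (\<lambda>f. map_pmf (\<lambda>g. merge I f g) (iid J b))"
    unfolding Pi_pmf_union[OF assms]
    by (simp add: pair_pmf_def map_bind_pmf map_pmf_def bind_assoc_pmf bind_return_pmf)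
  then show ?thesis by (simp add: prob_bind_pmf vimage_def)
qed

lemma prob_iid_Un_le:
  assumes "finite I" "finite J" "I \<inter> J = {}"
    and "\<And>f. f \<in> set_pmf (iid I b) \<Longrightarrow> measure_pmf.prob (iid J b) {g. merge I f g \<in> E} \<le> c"
  shows "measure_pmf.prob (iid (I \<union> J) b) E \<le> c"
  unfolding prob_iid_Un[OF assms(1-3)]
proof (rule measure_pmf.integral_le_const)
  show "integrable (iid I b) (\<lambda>f. measure_pmf.prob (iid J b) {g. merge I f g \<in> E})"
    by (rule measure_pmf.integrable_const_bound[where B = 1]) auto
qed (use assms(4) in \<open>auto simp: AE_measure_pmf_iff\<close>)

lemma prob_iid_Un_eq:
  assumes "finite I" "finite J" "I \<inter> J = {}"
    and "\<And>f g. merge I f g \<in> E \<longleftrightarrow> P f \<and> Q f g"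
    and "\<And>f. P f \<Longrightarrow> measure_pmf.prob (iid J b) {g. Q f g} = c"
  shows "measure_pmf.prob (iid (I \<union> J) b) E = measure_pmf.prob (iid I b) {f. P f} * c"
proof -
  have "(\<lambda>f. measure_pmf.prob (iid J b) {g. merge I f g \<in> E}) = (\<lambda>f. indicator {f. P f} f * c)"
    using assms(4,5) by (auto simp: indicator_def fun_eq_iff)
  then show ?thesis unfolding prob_iid_Un[OF assms(1-3)] by simp
qed

lemma prob_iid_subset:
  assumes "finite J" "I \<subseteq> J" "\<And>A B. (\<And>x. x \<in> I \<Longrightarrow> A x = B x) \<Longrightarrow> P A \<longleftrightarrow> P B"
  shows "measure_pmf.prob (iid J b) {A. P A} = measure_pmf.prob (iid I b) {A. P A}"
proof -
  have "P (\<lambda>x. if x \<in> I then A x else 0) = P A" for A by (rule assms(3)) simp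
  then show ?thesis by (simp add: Pi_pmf_subset[OF assms(1,2)] vimage_def)
qed

lemma prob_column_cong:
  "measure_pmf.prob (iid ({..<n} \<times> {m}) b) {g. \<forall>i<n. [g (i, m) = r i] (mod N)} =
   (\<Prod>i<n. measure_pmf.prob b {x. [x = r i] (mod N)})"
proof -
  have "{g. \<forall>i<n. [g (i, m) = r i] (mod N)} =
      Pi ({..<n} \<times> {m}) (\<lambda>x. {y. [y = r (fst x)] (mod N)})"
    by (auto simp: Pi_def)
  then have "measure_pmf.prob (iid ({..<n} \<times> {m}) b) {g. \<forall>i<n. [g (i, m) = r i] (mod N)} =
      (\<Prod>x\<in>{..<n} \<times> {m}. measure_pmf.prob b {y. [y = r (fst x)] (mod N)})"
    by (simp add: measure_Pi_pmf_Pi)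
  also have "\<dots> = (\<Prod>i<n. measure_pmf.prob b {x. [x = r i] (mod N)})"
    by (rule prod.reindex_bij_witness[of _ "\<lambda>i. (i, m)" fst]) auto
  finally show ?thesis .
qed

lemma column_index_Un: "{..<n} \<times> {..<Suc m} = ({..<n} \<times> {..<m}) \<union> ({..<n} \<times> {m})"
  by auto

lemma card_coefficients: "card ({..<m} \<rightarrow>\<^sub>E {0..<int p}) = p ^ m"
  by (simp add: card_PiE)

text \<open>Given the first \<open>j\<close> columns, column \<open>j\<close> has to be one of at most \<open>p ^ j\<close> combinations of them
  modulo \<open>p\<close>, each of which is hit with probability at most \<open>q ^ n\<close>.\<close>

lemma prob_rank_deficient_le:
  assumes p: "prime p" and q: "\<And>r. measure_pmf.prob b {x. [x = r] (mod int p)} \<le> q" 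
  shows "measure_pmf.prob (iid ({..<n} \<times> {..<m}) b) {A. rank_deficient p n m A}
    \<le> (\<Sum>j<m. real p ^ j * q ^ n)"
proof (induction m)
  case 0
  then show ?case by (simp add: rank_deficient_def)
next
  case (Suc m)
  let ?I = "{..<n} \<times> {..<m}" and ?J = "{..<n} \<times> {m}"
  let ?V = "{..<m} \<rightarrow>\<^sub>E {0..<int p}"
  define S where "S = {A. \<exists>v\<in>?V. \<forall>i<n. [A (i, m) = (\<Sum>j<m. A (i, j) * v j)] (mod int p)}"
  have "measure_pmf.prob (iid (?I \<union> ?J) b) S \<le> real p ^ m * q ^ n"
  proof (rule prob_iid_Un_le)
    fix f :: "nat \<times> nat \<Rightarrow> int"
    have "{g. merge ?I f g \<in> S} = (\<Union>v\<in>?V. {g. \<forall>i<n. [g (i, m) = (\<Sum>j<m. f (i, j) * v j)] (mod int p)})"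
      by (auto simp: S_def)
    then have "measure_pmf.prob (iid ?J b) {g. merge ?I f g \<in> S} \<le>
       (\<Sum>v\<in>?V. measure_pmf.prob (iid ?J b) {g. \<forall>i<n. [g (i, m) = (\<Sum>j<m. f (i, j) * v j)] (mod int p)})"
      by (simp only:) (rule measure_pmf.finite_measure_subadditive_finite, auto intro!: finite_PiE)
    also have "\<dots> \<le> (\<Sum>v\<in>?V. q ^ n)"
    proof (rule sum_mono)
      fix v
      have "(\<Prod>i<n. measure_pmf.prob b {x. [x = (\<Sum>j<m. f (i, j) * v j)] (mod int p)}) \<le> (\<Prod>i<n. q)"
        by (rule prod_mono) (simp add: q)
      then show "measure_pmf.prob (iid ?J b) {g. \<forall>i<n. [g (i, m) = (\<Sum>j<m. f (i, j) * v j)] (mod int p)}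
          \<le> q ^ n" unfolding prob_column_cong by simp
    qed
    also have "\<dots> = real p ^ m * q ^ n" by (simp add: card_coefficients)
    finally show "measure_pmf.prob (iid ?J b) {g. merge ?I f g \<in> S} \<le> real p ^ m * q ^ n" .
  qed auto
  moreover have "measure_pmf.prob (iid (?I \<union> ?J) b) {A. rank_deficient p n m A} =
      measure_pmf.prob (iid ?I b) {A. rank_deficient p n m A}"
    by (rule prob_iid_subset) (auto intro!: rank_deficient_cong)
  moreover have "{A. rank_deficient p n (Suc m) A} = {A. rank_deficient p n m A} \<union> S"
    using rank_deficient_Suc[OF p] by (auto simp: S_def)
  then have "measure_pmf.prob (iid (?I \<union> ?J) b) {A. rank_deficient p n (Suc m) A} \<le>
     measure_pmf.prob (iid (?I \<union> ?J) b) {A. rank_deficient p n m A} + measure_pmf.prob (iid (?I \<union> ?J) b) S"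
    by (simp only:) (rule measure_Un_le, auto)
  ultimately show ?case using Suc.IH unfolding column_index_Un by simp
qed

text \<open>If the first \<open>j\<close> columns are independent, their \<open>p ^ j\<close> combinations are distinct modulo \<open>p\<close>, so the
  bound of the previous lemma becomes an exact count.\<close>

lemma prob_full_rank_uniform:
  assumes p: "prime p" and q: "\<And>r. measure_pmf.prob b {x. [x = r] (mod int p)} = 1 / real p"
  shows "measure_pmf.prob (iid ({..<n} \<times> {..<m}) b) {A. \<not> rank_deficient p n m A}
    = (\<Prod>j<m. 1 - real p ^ j / real p ^ n)"
proof (induction m)
  case 0
  then show ?case by (simp add: rank_deficient_def)
next
  case (Suc m)
  let ?I = "{..<n} \<times> {..<m}" and ?J = "{..<n} \<times> {m}"
  let ?V = "{..<m} \<rightarrow>\<^sub>E {0..<int p}"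
  let ?Q = "\<lambda>f g v. \<forall>i<n. [g (i, m) = (\<Sum>j<m. f (i, j) * v j)] (mod int p)"
  have "measure_pmf.prob (iid (?I \<union> ?J) b) {A. \<not> rank_deficient p n (Suc m) A} =
      measure_pmf.prob (iid ?I b) {A. \<not> rank_deficient p n m A} * (1 - real p ^ m / real p ^ n)"
  proof (rule prob_iid_Un_eq[where Q = "\<lambda>f g. \<not> (\<exists>v\<in>?V. ?Q f g v)"])
    fix f g :: "nat \<times> nat \<Rightarrow> int"
    have "rank_deficient p n m (merge ?I f g) = rank_deficient p n m f"
      by (rule rank_deficient_cong) auto
    moreover have "[merge ?I f g (i, m) = (\<Sum>j<m. merge ?I f g (i, j) * v j)] (mod int p) \<longleftrightarrow>
        [g (i, m) = (\<Sum>j<m. f (i, j) * v j)] (mod int p)" if "i < n" for i v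
    proof -
      have "(\<Sum>j<m. merge ?I f g (i, j) * v j) = (\<Sum>j<m. f (i, j) * v j)"
        using that by (intro sum.cong) auto
      then show ?thesis by simp
    qed
    ultimately show "merge ?I f g \<in> {A. \<not> rank_deficient p n (Suc m) A} \<longleftrightarrow>
        \<not> rank_deficient p n m f \<and> \<not> (\<exists>v\<in>?V. ?Q f g v)"
      unfolding mem_Collect_eq rank_deficient_Suc[OF p] by meson
  next
    fix f :: "nat \<times> nat \<Rightarrow> int"
    assume f: "\<not> rank_deficient p n m f"
    have disj: "disjoint_family_on (\<lambda>v. {g. ?Q f g v}) ?V"
      unfolding disjoint_family_on_def
    proof (intro ballI impI)
      fix v w assume vw: "v \<in> ?V" "w \<in> ?V" "v \<noteq> w"
      show "{g. ?Q f g v} \<inter> {g. ?Q f g w} = {}"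
      proof (rule ccontr)
        assume "\<not> ?thesis"
        then obtain g where g: "?Q f g v" "?Q f g w" by auto
        have "int p dvd (\<Sum>j<m. f (i, j) * (v j - w j))" if "i < n" for i
        proof -
          have "[(\<Sum>j<m. f (i, j) * v j) = (\<Sum>j<m. f (i, j) * w j)] (mod int p)"
            using g that by (meson cong_sym cong_trans)
          then show ?thesis by (simp add: cong_iff_dvd_diff right_diff_distrib sum_subtractf)
        qed
        then have dv: "int p dvd v j - w j" if "j < m" for j
          using f that rank_deficientI[of j m p "\<lambda>j. v j - w j" n f] by blast
        have "v j = w j" if "j \<in> {..<m}" for j
        proof -
          have "v j mod int p = w j mod int p" using dv[of j] that by (simp add: mod_eq_dvd_iff)
          moreover have "v j \<in> {0..<int p}" "w j \<in> {0..<int p}" 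
            using PiE_mem[OF vw(1) that] PiE_mem[OF vw(2) that] by simp_all
          ultimately show ?thesis by simp
        qed
        with vw show False by (meson PiE_ext)
      qed
    qed
    have "measure_pmf.prob (iid ?J b) (\<Union>v\<in>?V. {g. ?Q f g v}) =
        (\<Sum>v\<in>?V. measure_pmf.prob (iid ?J b) {g. ?Q f g v})"
      by (rule measure_pmf.finite_measure_finite_Union[OF _ _ disj]) (auto intro!: finite_PiE)
    also have "\<dots> = (\<Sum>v\<in>?V. (1 / real p) ^ n)" by (simp add: prob_column_cong q)
    also have "\<dots> = real p ^ m / real p ^ n" by (simp add: card_coefficients power_one_over)
    finally have "measure_pmf.prob (iid ?J b) (\<Union>v\<in>?V. {g. ?Q f g v}) = real p ^ m / real p ^ n" .
    moreover have "{g. \<not> (\<exists>v\<in>?V. ?Q f g v)} = space (iid ?J b) - (\<Union>v\<in>?V. {g. ?Q f g v})" by auto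
    moreover have "measure_pmf.prob (iid ?J b) (space (iid ?J b) - X) = 1 - measure_pmf.prob (iid ?J b) X" for X
      by (rule measure_pmf.prob_compl) simp
    ultimately show "measure_pmf.prob (iid ?J b) {g. \<not> (\<exists>v\<in>?V. ?Q f g v)} = 1 - real p ^ m / real p ^ n"
      by (simp only:)
  qed auto
  then show ?case using Suc.IH unfolding column_index_Un by simp
qed

section \<open>Equidistribution and the Chinese remainder theorem\<close>

text \<open>A window of \<open>N\<close> consecutive integers contains exactly one element of each residue class.\<close>

lemma card_residue_class_window:
  assumes "N > 0"
  shows "card {x \<in> {a..<a + int t * N}. [x = r] (mod N)} = t"
proof (induction t)
  case (Suc t)
  let ?c = "a + int t * N"
  define y where "y = ?c + (r - ?c) mod N"
  have y: "y \<in> {?c..<?c + N}" "[y = r] (mod N)"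
    using assms by (auto simp: y_def cong_def mod_simps)
  have "{x \<in> {?c..<?c + N}. [x = r] (mod N)} = {y}"
  proof (intro equalityI subsetI)
    fix x assume x: "x \<in> {x \<in> {?c..<?c + N}. [x = r] (mod N)}"
    then have "[x = y] (mod N)" using cong_trans[OF _ cong_sym[OF y(2)]] by simp
    then have "N dvd x - y" by (simp add: cong_iff_dvd_diff)
    moreover have "\<bar>x - y\<bar> < N" using x y(1) by auto
    ultimately have "x - y = 0" using dvd_imp_le_int[of "x - y" N] assms by linarith
    then show "x \<in> {y}" by simp
  qed (use y in auto)
  moreover have "{x \<in> {a..<a + int (Suc t) * N}. [x = r] (mod N)} =
      {x \<in> {a..<?c}. [x = r] (mod N)} \<union> {x \<in> {?c..<?c + N}. [x = r] (mod N)}"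
  proof -
    have "a + int (Suc t) * N = ?c + N" by (simp add: algebra_simps)
    moreover have "{a..<?c + N} = {a..<?c} \<union> {?c..<?c + N}"
      using assms by (intro ivl_disj_un_two(3)[symmetric]) auto
    ultimately show ?thesis by (simp only:) blast
  qed
  moreover have "card ({x \<in> {a..<?c}. [x = r] (mod N)} \<union> {y}) = Suc t"
  proof -
    have "finite {x \<in> {a..<?c}. [x = r] (mod N)}" by (rule finite_subset[of _ "{a..<?c}"]) auto
    then show ?thesis using y(1) Suc.IH by (subst card_Un_disjoint) auto
  qed
  ultimately show ?case by simp
qed simp

lemma card_residue_class_interval:
  assumes "N > 0"
  shows "L div N \<le> card {x \<in> {a..<a + int L}. [x = r] (mod int N)}"
    and "card {x \<in> {a..<a + int L}. [x = r] (mod int N)} \<le> L div N + 1"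
proof -
  let ?S = "\<lambda>t. {x \<in> {a..<a + int t * int N}. [x = r] (mod int N)}"
  have c: "card (?S t) = t" for t using card_residue_class_window[of "int N"] assms by simp
  have fin: "finite {x \<in> {a..<b}. Q x}" for b :: int and Q by (rule finite_subset[of _ "{a..<b}"]) auto
  have "L div N * N \<le> L" by (simp add: div_times_less_eq_dividend)
  then have "int (L div N) * int N \<le> int L" by (metis of_nat_le_iff of_nat_mult)
  then have "?S (L div N) \<subseteq> {x \<in> {a..<a + int L}. [x = r] (mod int N)}" by auto
  from card_mono[OF fin this] show "L div N \<le> card {x \<in> {a..<a + int L}. [x = r] (mod int N)}"
    unfolding c by simp
  have "L < (L div N + 1) * N" using assms by (metis Suc_eq_plus1 dividend_less_div_times mult_Suc)
  then have "int L < int (L div N + 1) * int N" by (metis of_nat_less_iff of_nat_mult)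
  then have "{x \<in> {a..<a + int L}. [x = r] (mod int N)} \<subseteq> ?S (L div N + 1)" by auto
  from card_mono[OF fin this] show "card {x \<in> {a..<a + int L}. [x = r] (mod int N)} \<le> L div N + 1"
    unfolding c by simp
qed

abbreviation unif_box :: "nat \<Rightarrow> int pmf" where
  "unif_box k \<equiv> pmf_of_set {- int k..int k}"

abbreviation unif_mod :: "nat \<Rightarrow> int pmf" where
  "unif_mod N \<equiv> pmf_of_set {0..<int N}"

lemma prob_unif_box_cong:
  "measure_pmf.prob (unif_box k) {x. [x = r] (mod N)} =
   card {x \<in> {- int k..<- int k + int (2 * k + 1)}. [x = r] (mod N)} / real (2 * k + 1)"
proof -
  have "{- int k..int k} \<inter> {x. [x = r] (mod N)} =
      {x \<in> {- int k..<- int k + int (2 * k + 1)}. [x = r] (mod N)}" by auto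
  moreover have "card {- int k..int k} = 2 * k + 1" by simp
  ultimately show ?thesis by (subst measure_pmf_of_set) (simp_all del: card_atLeastAtMost_int)
qed

lemma prob_unif_box_cong_le:
  assumes "N > 0" "N \<le> 2 * k + 1"
  shows "measure_pmf.prob (unif_box k) {x. [x = r] (mod int N)} \<le> 2 / real N"
proof -
  let ?c = "card {x \<in> {- int k..<- int k + int (2 * k + 1)}. [x = r] (mod int N)}"
  have "?c * N \<le> ((2 * k + 1) div N + 1) * N"
    by (intro mult_right_mono card_residue_class_interval assms) simp
  also have "\<dots> = (2 * k + 1) div N * N + N" by (simp only: add_mult_distrib mult_1)
  also have "\<dots> \<le> (2 * k + 1) + (2 * k + 1)"
    by (intro add_mono div_times_less_eq_dividend assms)
  also have "\<dots> = 2 * (2 * k + 1)" by simp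
  finally have "real (?c * N) \<le> real (2 * (2 * k + 1))" by (simp only: of_nat_le_iff)
  then have "real ?c * real N \<le> 2 * real (2 * k + 1)" by (simp only: of_nat_mult of_nat_numeral)
  then have "real ?c \<le> 2 * real (2 * k + 1) / real N" using assms by (simp only: pos_le_divide_eq of_nat_0_less_iff)
  then have "real ?c / real (2 * k + 1) \<le> 2 * real (2 * k + 1) / real N / real (2 * k + 1)"
    by (intro divide_right_mono) auto
  also have "\<dots> = 2 / real N" by (simp del: of_nat_add of_nat_Suc)
  finally show ?thesis unfolding prob_unif_box_cong .
qed

text \<open>A modulus exceeding the length of the box separates its points.\<close>

lemma prob_unif_box_cong_le_large:
  assumes "N > 2 * k + 1"
  shows "measure_pmf.prob (unif_box k) {x. [x = r] (mod int N)} \<le> 1 / real (2 * k + 1)"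
proof -
  let ?c = "card {x \<in> {- int k..<- int k + int (2 * k + 1)}. [x = r] (mod int N)}"
  have "?c \<le> (2 * k + 1) div N + 1"
    using assms by (intro card_residue_class_interval) auto
  also have "\<dots> = 1" using assms by simp
  finally show ?thesis unfolding prob_unif_box_cong by (intro divide_right_mono) auto
qed

lemma prob_unif_box_cong_tendsto:
  assumes "N > 0"
  shows "(\<lambda>k. measure_pmf.prob (unif_box k) {x. [x = r] (mod int N)}) \<longlonglongrightarrow> 1 / real N"
proof -
  let ?c = "\<lambda>k. card {x \<in> {- int k..<- int k + int (2 * k + 1)}. [x = r] (mod int N)}"
  have b: "\<bar>real (?c k) - real (2 * k + 1) / real N\<bar> \<le> 1" for k
  proof -
    have "real ((2 * k + 1) div N) \<le> real (2 * k + 1) / real N"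
      by (rule of_nat_div_le_of_nat)
    moreover have "real (2 * k + 1) / real N \<le> real ((2 * k + 1) div N) + 1"
      using floor_correct[of "real (2 * k + 1) / real N"] unfolding floor_divide_of_nat_eq by simp
    moreover have "real ((2 * k + 1) div N) \<le> real (?c k)" "real (?c k) \<le> real ((2 * k + 1) div N) + 1"
      using card_residue_class_interval[OF assms, where L = "2 * k + 1" and a = "- int k" and r = r] by linarith+
    ultimately show ?thesis by linarith
  qed
  have "(\<lambda>k. measure_pmf.prob (unif_box k) {x. [x = r] (mod int N)} - 1 / real N) \<longlonglongrightarrow> 0"
  proof (rule Lim_null_comparison)
    show "\<forall>\<^sub>F k in sequentially.
        norm (measure_pmf.prob (unif_box k) {x. [x = r] (mod int N)} - 1 / real N) \<le> 1 / real (2 * k + 1)"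
    proof (intro always_eventually allI)
      fix k
      have "measure_pmf.prob (unif_box k) {x. [x = r] (mod int N)} - 1 / real N =
          (real (?c k) - real (2 * k + 1) / real N) / real (2 * k + 1)"
        unfolding prob_unif_box_cong by (simp add: diff_divide_distrib)
      then show "norm (measure_pmf.prob (unif_box k) {x. [x = r] (mod int N)} - 1 / real N) \<le> 1 / real (2 * k + 1)"
        using b[of k] by (simp add: abs_divide divide_right_mono)
    qed
    show "(\<lambda>k. 1 / real (2 * k + 1)) \<longlonglongrightarrow> 0" by real_asymp
  qed
  then show ?thesis by (rule LIM_zero_cancel)
qed

lemma prob_unif_mod_cong:
  assumes "N > 0" "d dvd N"
  shows "measure_pmf.prob (unif_mod N) {x. [x = r] (mod int d)} = 1 / real d"
proof -
  obtain t where t: "N = d * t" using assms by auto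
  have d: "d > 0" "t > 0" using assms t by (auto intro: Nat.gr0I)
  have "card {x \<in> {0..<0 + int t * int d}. [x = r] (mod int d)} = t"
    using d by (intro card_residue_class_window) simp
  moreover have "{0..<int N} \<inter> {x. [x = r] (mod int d)} = {x \<in> {0..<0 + int t * int d}. [x = r] (mod int d)}"
    by (auto simp: t mult.commute)
  ultimately have "measure_pmf.prob (unif_mod N) {x. [x = r] (mod int d)} = real t / real N"
    using assms by (subst measure_pmf_of_set) auto
  then show ?thesis using d t by simp
qed

text \<open>On a finite sample space, convergence of the individual weights is convergence of all
  probabilities.\<close>

lemma prob_Pi_pmf_tendsto:
  fixes b :: "nat \<Rightarrow> int pmf"
  assumes I: "finite I" and S: "finite S" "\<And>k. set_pmf (b k) \<subseteq> S" "set_pmf c \<subseteq> S"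
    and lim: "\<And>x. (\<lambda>k. pmf (b k) x) \<longlonglongrightarrow> pmf c x"
  shows "(\<lambda>k. measure_pmf.prob (iid I (b k)) E) \<longlonglongrightarrow> measure_pmf.prob (iid I c) E"
proof -
  let ?F = "PiE_dflt I 0 (\<lambda>_. S)"
  have fin: "finite ?F" using I S by (intro finite_PiE_dflt) auto
  have *: "measure_pmf.prob (iid I q) E = (\<Sum>f\<in>E \<inter> ?F. \<Prod>x\<in>I. pmf q (f x))" if "set_pmf q \<subseteq> S" for q
  proof -
    have "set_pmf (iid I q) \<subseteq> ?F" using that I by (auto simp: set_Pi_pmf PiE_dflt_def)
    then have "measure_pmf.prob (iid I q) E = measure_pmf.prob (iid I q) (E \<inter> ?F)"
      by (intro measure_pmf.finite_measure_eq_AE) (auto simp: AE_measure_pmf_iff)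
    also have "\<dots> = (\<Sum>f\<in>E \<inter> ?F. pmf (iid I q) f)" using fin by (intro measure_measure_pmf_finite) auto
    also have "\<dots> = (\<Sum>f\<in>E \<inter> ?F. \<Prod>x\<in>I. pmf q (f x))"
      using I by (intro sum.cong refl pmf_Pi') (auto simp: PiE_dflt_def)
    finally show ?thesis .
  qed
  show ?thesis unfolding *[OF S(2)] *[OF S(3)] by (intro tendsto_sum tendsto_prod lim)
qed

lemma prob_box_periodic_tendsto:
  assumes I: "finite I" and N: "N > 0"
    and E: "\<And>A. P (\<lambda>x. A x mod int N) \<longleftrightarrow> P A"
  shows "(\<lambda>k. measure_pmf.prob (iid I (unif_box k)) {A. P A}) \<longlonglongrightarrow> measure_pmf.prob (iid I (unif_mod N)) {A. P A}"
proof -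
  let ?b = "\<lambda>k. map_pmf (\<lambda>x. x mod int N) (unif_box k)"
  have N': "int N > 0" "{0..<int N} \<noteq> {}" using N by auto
  have "(\<lambda>k. measure_pmf.prob (iid I (?b k)) {A. P A}) \<longlonglongrightarrow> measure_pmf.prob (iid I (unif_mod N)) {A. P A}"
  proof (rule prob_Pi_pmf_tendsto[OF I, of "{0..<int N}"])
    fix x
    have "{y. y mod int N = x} = (if x \<in> {0..<int N} then {y. [y = x] (mod int N)} else {})"
      using N' by (auto simp: cong_def)
    then have "(\<lambda>k. pmf (?b k) x) = (\<lambda>k. if x \<in> {0..<int N} then measure_pmf.prob (unif_box k) {y. [y = x] (mod int N)} else 0)"
      by (auto simp: pmf_map vimage_def)
    moreover have "pmf (unif_mod N) x = (if x \<in> {0..<int N} then 1 / real N else 0)"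
      using N' by (simp add: indicator_def)
    ultimately show "(\<lambda>k. pmf (?b k) x) \<longlonglongrightarrow> pmf (unif_mod N) x"
      using prob_unif_box_cong_tendsto[OF N, of x] by (cases "x \<in> {0..<int N}") (simp_all only: if_True if_False tendsto_const)
  qed (use N' in auto)
  moreover have "measure_pmf.prob (iid I (?b k)) {A. P A} = measure_pmf.prob (iid I (unif_box k)) {A. P A}" for k
    using E by (subst Pi_pmf_map[OF I]) (simp_all add: vimage_def o_def)
  ultimately show ?thesis by simp
qed

text \<open>The Chinese remainder theorem as a statement about distributions: the residues modulo
  coprime \<open>a\<close> and \<open>c\<close> of a uniform residue modulo \<open>a * c\<close> are independent and uniform.\<close>

lemma map_pmf_unif_mod_chinese:
  assumes "a > 0" "c > 0" "coprime a c"
  shows "map_pmf (\<lambda>x. (x mod int a, x mod int c)) (unif_mod (a * c)) = pair_pmf (unif_mod a) (unif_mod c)"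
proof -
  have ne: "{0..<int a} \<noteq> {}" "{0..<int c} \<noteq> {}" using assms by auto
  have bij: "bij_betw (\<lambda>x. (x mod int a, x mod int c)) {0..<int (a * c)} ({0..<int a} \<times> {0..<int c})"
  proof -
    have inj: "inj_on (\<lambda>x. (x mod int a, x mod int c)) {0..<int (a * c)}"
    proof (rule inj_onI)
      fix x y assume xy: "x \<in> {0..<int (a * c)}" "y \<in> {0..<int (a * c)}"
        "(x mod int a, x mod int c) = (y mod int a, y mod int c)"
      then have "[x = y] (mod int a)" "[x = y] (mod int c)" by (auto simp: cong_def)
      moreover have "coprime (int a) (int c)" using assms by simp
      ultimately have "[x = y] (mod int a * int c)" by (rule coprime_cong_mult)
      then show "x = y" using xy by (auto simp: cong_def)
    qed
    moreover have "(\<lambda>x. (x mod int a, x mod int c)) ` {0..<int (a * c)} = {0..<int a} \<times> {0..<int c}"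
    proof (rule card_subset_eq)
      show "(\<lambda>x. (x mod int a, x mod int c)) ` {0..<int (a * c)} \<subseteq> {0..<int a} \<times> {0..<int c}"
        using assms by auto
      show "card ((\<lambda>x. (x mod int a, x mod int c)) ` {0..<int (a * c)}) = card ({0..<int a} \<times> {0..<int c})"
        unfolding card_image[OF inj] by (simp add: nat_mult_distrib)
    qed auto
    ultimately show ?thesis by (simp add: bij_betw_def)
  qed
  have "map_pmf (\<lambda>x. (x mod int a, x mod int c)) (unif_mod (a * c)) = pmf_of_set ({0..<int a} \<times> {0..<int c})"
    using assms by (intro map_pmf_of_set_bij_betw[OF bij]) auto
  also have "\<dots> = pair_pmf (unif_mod a) (unif_mod c)"
    using ne by (intro pmf_eqI) (auto simp: pmf_pair indicator_def)
  finally show ?thesis .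
qed

lemma Pi_pmf_pair_pmf:
  fixes I :: "'a set" and p :: "'b pmf" and q :: "'c pmf"
  assumes "finite I"
  shows "Pi_pmf I (d, e) (\<lambda>_. pair_pmf p q) =
    map_pmf (\<lambda>(f, g) x. (f x, g x)) (pair_pmf (Pi_pmf I d (\<lambda>_. p)) (Pi_pmf I e (\<lambda>_. q)))"
proof (rule pmf_eqI)
  fix h :: "'a \<Rightarrow> 'b \<times> 'c"
  let ?F = "\<lambda>(f :: 'a \<Rightarrow> 'b, g :: 'a \<Rightarrow> 'c) x. (f x, g x)"
  have inj: "inj ?F" by (auto simp: inj_def fun_eq_iff)
  have h: "h = ?F (fst \<circ> h, snd \<circ> h)" by (simp add: fun_eq_iff)
  have "pmf (map_pmf ?F (pair_pmf (Pi_pmf I d (\<lambda>_. p)) (Pi_pmf I e (\<lambda>_. q)))) h =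
      pmf (pair_pmf (Pi_pmf I d (\<lambda>_. p)) (Pi_pmf I e (\<lambda>_. q))) (fst \<circ> h, snd \<circ> h)"
    by (subst h, rule pmf_map_inj'[OF inj])
  also have "\<dots> = pmf (Pi_pmf I (d, e) (\<lambda>_. pair_pmf p q)) h"
  proof -
    let ?c = "\<forall>x. x \<notin> I \<longrightarrow> fst (h x) = d" and ?e = "\<forall>x. x \<notin> I \<longrightarrow> snd (h x) = e"
    have 1: "pmf (pair_pmf p q) (h x) = pmf p (fst (h x)) * pmf q (snd (h x))" for x
      by (metis pmf_pair prod.collapse)
    have 2: "(\<forall>x. x \<notin> I \<longrightarrow> h x = (d, e)) \<longleftrightarrow> ?c \<and> ?e"
      by (metis prod.collapse fst_conv snd_conv)
    have 3: "(if A then x else 0) * (if B then y else 0) = (if A \<and> B then x * y else 0)" for A B and x y :: real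
      by simp
    show ?thesis by (simp only: pmf_pair pmf_Pi[OF assms] 1 2 3 prod.distrib o_apply)
  qed
  finally show "pmf (Pi_pmf I (d, e) (\<lambda>_. pair_pmf p q)) h =
      pmf (map_pmf ?F (pair_pmf (Pi_pmf I d (\<lambda>_. p)) (Pi_pmf I e (\<lambda>_. q)))) h" ..
qed

lemma prob_pair_pmf_Times:
  "measure_pmf.prob (pair_pmf p q) (X \<times> Y) = measure_pmf.prob p X * measure_pmf.prob q Y"
proof -
  have "measure_pmf.prob (pair_pmf p q) (X \<times> Y) =
      measure_pmf.prob (pair_pmf p q) ((X \<inter> set_pmf p) \<times> (Y \<inter> set_pmf q))"
    by (intro measure_pmf.finite_measure_eq_AE) (auto simp: AE_measure_pmf_iff)
  also have "\<dots> = measure_pmf.prob p (X \<inter> set_pmf p) * measure_pmf.prob q (Y \<inter> set_pmf q)"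
    by (intro measure_pmf_prob_product) auto
  finally show ?thesis by (simp add: measure_Int_set_pmf)
qed

lemma prob_unif_mod_chinese:
  assumes I: "finite I" and ac: "a > 0" "c > 0" "coprime a c"
    and P: "\<And>A. P (\<lambda>x. A x mod int a) \<longleftrightarrow> P A" and Q: "\<And>A. Q (\<lambda>x. A x mod int c) \<longleftrightarrow> Q A"
  shows "measure_pmf.prob (iid I (unif_mod (a * c))) {A. P A \<and> Q A} =
    measure_pmf.prob (iid I (unif_mod a)) {A. P A} * measure_pmf.prob (iid I (unif_mod c)) {A. Q A}"
proof -
  let ?m = "\<lambda>x. (x mod int a, x mod int c)"
  let ?T = "{h. P (fst \<circ> h) \<and> Q (snd \<circ> h)}"
  have "measure_pmf.prob (iid I (unif_mod (a * c))) {A. P A \<and> Q A} =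
      measure_pmf.prob (map_pmf (\<lambda>A. ?m \<circ> A) (iid I (unif_mod (a * c)))) ?T"
    using P Q by (simp add: vimage_def o_def)
  also have "map_pmf (\<lambda>A. ?m \<circ> A) (iid I (unif_mod (a * c))) =
      Pi_pmf I (0, 0) (\<lambda>_. pair_pmf (unif_mod a) (unif_mod c))"
    unfolding map_pmf_unif_mod_chinese[OF ac, symmetric] by (rule Pi_pmf_map[symmetric]) (use I in auto)
  also have "measure_pmf.prob \<dots> ?T =
      measure_pmf.prob (pair_pmf (iid I (unif_mod a)) (iid I (unif_mod c))) ({A. P A} \<times> {A. Q A})"
  proof -
    have "(\<lambda>(f, g) x. (f x, g x)) -` ?T = {A. P A} \<times> {A. Q A}" by (auto simp: o_def)
    then show ?thesis unfolding Pi_pmf_pair_pmf[OF I] measure_map_pmf by (simp only:)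
  qed
  also have "\<dots> = measure_pmf.prob (iid I (unif_mod a)) {A. P A} * measure_pmf.prob (iid I (unif_mod c)) {A. Q A}"
    by (rule prob_pair_pmf_Times)
  finally show ?thesis .
qed

lemma prob_full_rank_finite_primes:
  assumes F: "finite F" "\<And>p. p \<in> F \<Longrightarrow> prime p"
  shows "measure_pmf.prob (iid ({..<n} \<times> {..<m}) (unif_mod (\<Prod>F))) {A. \<forall>p\<in>F. \<not> rank_deficient p n m A} =
    (\<Prod>p\<in>F. \<Prod>j<m. 1 - real p ^ j / real p ^ n)"
  using F
proof (induction F rule: finite_induct)
  case (insert p F)
  have p: "prime p" "p > 0" using insert.prems by (auto simp: prime_gt_0_nat)
  have pos: "\<Prod>F > 0" using insert.prems by (intro prod_pos) (auto simp: prime_gt_0_nat)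
  have cop: "coprime p (\<Prod>F)"
    using insert.prems insert.hyps p by (intro prod_coprime_right) (metis insertCI primes_coprime)
  have "measure_pmf.prob (iid ({..<n} \<times> {..<m}) (unif_mod (p * \<Prod>F)))
       {A. \<not> rank_deficient p n m A \<and> (\<forall>q\<in>F. \<not> rank_deficient q n m A)} =
     measure_pmf.prob (iid ({..<n} \<times> {..<m}) (unif_mod p)) {A. \<not> rank_deficient p n m A} *
     measure_pmf.prob (iid ({..<n} \<times> {..<m}) (unif_mod (\<Prod>F))) {A. \<forall>q\<in>F. \<not> rank_deficient q n m A}"
  proof (rule prob_unif_mod_chinese[OF _ p(2) pos cop])
    show "(\<forall>q\<in>F. \<not> rank_deficient q n m (\<lambda>x. A x mod int (\<Prod>F))) \<longleftrightarrow> (\<forall>q\<in>F. \<not> rank_deficient q n m A)" for A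
      using rank_deficient_mod[of _ "\<Prod>F" n m A] insert.hyps by (metis dvd_prodI)
  qed (auto simp: rank_deficient_mod)
  also have "measure_pmf.prob (iid ({..<n} \<times> {..<m}) (unif_mod p)) {A. \<not> rank_deficient p n m A} =
      (\<Prod>j<m. 1 - real p ^ j / real p ^ n)"
    using p by (intro prob_full_rank_uniform prob_unif_mod_cong) auto
  finally show ?case using insert by simp
qed simp

lemma prob_full_rank_finite_primes_tendsto:
  assumes F: "finite F" "\<And>p. p \<in> F \<Longrightarrow> prime p"
  shows "(\<lambda>k. measure_pmf.prob (iid ({..<n} \<times> {..<m}) (unif_box k)) {A. \<forall>p\<in>F. \<not> rank_deficient p n m A})
    \<longlonglongrightarrow> (\<Prod>p\<in>F. \<Prod>j<m. 1 - real p ^ j / real p ^ n)"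
proof -
  let ?P = "\<lambda>A. \<forall>p\<in>F. \<not> rank_deficient p n m A"
  have "(\<lambda>k. measure_pmf.prob (iid ({..<n} \<times> {..<m}) (unif_box k)) {A. ?P A})
     \<longlonglongrightarrow> measure_pmf.prob (iid ({..<n} \<times> {..<m}) (unif_mod (\<Prod>F))) {A. ?P A}"
  proof (rule prob_box_periodic_tendsto)
    show "\<Prod>F > 0" using F by (intro prod_pos) (auto simp: prime_gt_0_nat)
    show "?P (\<lambda>x. A x mod int (\<Prod>F)) \<longleftrightarrow> ?P A" for A
      using rank_deficient_mod[of _ "\<Prod>F" n m A] F(1) by (metis dvd_prodI)
  qed auto
  then show ?thesis by (simp only: prob_full_rank_finite_primes[OF F])
qed

section \<open>Large primes are negligible\<close>

lemma mult_mat_vec_sum: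
  assumes "i < n"
  shows "vec_index (Matrix.mat n m A *\<^sub>v Matrix.vec m v) i = (\<Sum>j<m. A (i, j) * v j)"
  using assms by (simp add: scalar_prod_def lessThan_atLeast0)

text \<open>Multiplying a kernel vector modulo \<open>p\<close> by the adjugate gives \<open>det M * v j \<equiv> 0\<close> for every \<open>j\<close>.\<close>

lemma rank_deficient_imp_dvd_det:
  assumes p: "prime p" and A: "rank_deficient p m m A"
  shows "int p dvd det (Matrix.mat m m A)"
proof -
  obtain v j where v: "j < m" "\<not> int p dvd v j" "\<And>i. i < m \<Longrightarrow> int p dvd (\<Sum>j<m. A (i, j) * v j)"
    using A unfolding rank_deficient_def by blast
  let ?M = "Matrix.mat m m A" and ?x = "Matrix.vec m v"
  have M: "?M \<in> carrier_mat m m" and x: "?x \<in> carrier_vec m" by auto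
  note adj = adj_mat[OF M]
  have "adj_mat ?M *\<^sub>v (?M *\<^sub>v ?x) = (adj_mat ?M * ?M) *\<^sub>v ?x"
    using adj(1) M x by (metis assoc_mult_mat_vec)
  also have "\<dots> = det ?M \<cdot>\<^sub>v ?x" 
    unfolding adj(3)
  proof (intro eq_vecI)
    fix i assume "i < dim_vec (det ?M \<cdot>\<^sub>v ?x)"
    then have i: "i < m" by simp
    have "(\<Sum>l = 0..<m. det ?M * (if l = i then 1 else 0) * v l) = (\<Sum>l = 0..<m. if l = i then det ?M * v l else 0)"
      by (intro sum.cong) auto
    then show "vec_index (det ?M \<cdot>\<^sub>m 1\<^sub>m m *\<^sub>v ?x) i = vec_index (det ?M \<cdot>\<^sub>v ?x) i"
      using i by (simp add: scalar_prod_def)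
  qed auto
  finally have "det ?M * v j = vec_index (adj_mat ?M *\<^sub>v (?M *\<^sub>v ?x)) j" using v(1) by simp
  also have "\<dots> = (\<Sum>i<m. adj_mat ?M $$ (j, i) * vec_index (?M *\<^sub>v ?x) i)"
    using v(1) adj(1) by (simp add: scalar_prod_def lessThan_atLeast0)
  also have "int p dvd \<dots>"
  proof (intro dvd_sum dvd_mult)
    fix i assume "i \<in> {..<m}"
    then show "int p dvd vec_index (?M *\<^sub>v ?x) i"
      using v(3) mult_mat_vec_sum[of i m m A v] by simp
  qed
  finally show ?thesis using p v(2) by (metis prime_dvd_mult_iff prime_nat_int_transfer)
qed

text \<open>An integral kernel vector can be divided by \<open>p\<close> until it is nonzero modulo \<open>p\<close>.\<close>

lemma integer_kernel_imp_rank_deficient: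
  assumes p: "p > 1" and "\<exists>j<m. v j \<noteq> 0" "\<And>i. i < n \<Longrightarrow> (\<Sum>j<m. A (i, j) * v j) = (0::int)"
  shows "rank_deficient p n m A"
  using assms(2,3)
proof (induction "\<Sum>j<m. nat \<bar>v j\<bar>" arbitrary: v rule: less_induct)
  case less
  show ?case
  proof (cases "\<exists>j<m. \<not> int p dvd v j")
    case True
    then show ?thesis using less.prems(2) by (auto simp: rank_deficient_def intro!: exI[of _ v])
  next
    case False
    define w where "w j = v j div int p" for j
    have w: "v j = int p * w j" if "j < m" for j using False that by (auto simp: w_def)
    obtain j where j: "j < m" "v j \<noteq> 0" using less.prems(1) by blast
    have le: "nat \<bar>w j\<bar> \<le> nat \<bar>v j\<bar>" if "j < m" for j
      using p unfolding w[OF that] by (simp add: abs_mult nat_mult_distrib)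
    have "(\<Sum>j<m. nat \<bar>w j\<bar>) < (\<Sum>j<m. nat \<bar>v j\<bar>)"
    proof (rule sum_strict_mono_strong[of _ j])
      have "w j \<noteq> 0" using j w[OF j(1)] by auto
      then show "nat \<bar>w j\<bar> < nat \<bar>v j\<bar>"
        using p unfolding w[OF j(1)] by (simp add: abs_mult nat_mult_distrib)
    qed (use j le in auto)
    moreover have "\<exists>j<m. w j \<noteq> 0" using j w[OF j(1)] by auto
    moreover have "(\<Sum>j<m. A (i, j) * w j) = 0" if "i < n" for i
    proof -
      have "int p * (\<Sum>j<m. A (i, j) * w j) = (\<Sum>j<m. A (i, j) * v j)"
        unfolding sum_distrib_left using w by (intro sum.cong) auto
      then show ?thesis using less.prems(2)[OF that] p by simp
    qed
    ultimately show ?thesis by (rule less.hyps)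
  qed
qed

lemma det_0_imp_rank_deficient:
  assumes p: "prime p" and det: "det (Matrix.mat m m A) = (0::int)"
  shows "rank_deficient p m m A"
proof -
  obtain x where x: "x \<in> carrier_vec m" "x \<noteq> 0\<^sub>v m" "Matrix.mat m m A *\<^sub>v x = 0\<^sub>v m"
    using det det_0_iff_vec_prod_zero[of "Matrix.mat m m A" m] by auto
  define v where "v j = vec_index x j" for j
  have xv: "x = Matrix.vec m v" using x(1) by (auto simp: v_def intro!: eq_vecI)
  show ?thesis
  proof (rule integer_kernel_imp_rank_deficient)
    show "p > 1" using p by (rule prime_gt_1_nat)
    show "\<exists>j<m. v j \<noteq> 0"
    proof (rule ccontr)
      assume "\<not> ?thesis"
      then have "x = 0\<^sub>v m" unfolding xv by (intro eq_vecI) auto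
      with x(2) show False ..
    qed
    show "(\<Sum>j<m. A (i, j) * v j) = 0" if "i < m" for i
      using x(3) mult_mat_vec_sum[OF that, of m A v] that unfolding xv by simp
  qed
qed

lemma abs_det_le:
  assumes "\<And>i j. i < m \<Longrightarrow> j < m \<Longrightarrow> \<bar>A (i, j)\<bar> \<le> (c::int)"
  shows "\<bar>det (Matrix.mat m m A)\<bar> \<le> fact m * c ^ m"
proof -
  let ?S = "{\<pi>. \<pi> permutes {0..<m}}"
  have "det (Matrix.mat m m A) = (\<Sum>\<pi>\<in>?S. signof \<pi> * (\<Prod>i = 0..<m. Matrix.mat m m A $$ (i, \<pi> i)))"
    by (rule det_def') simp
  then have "\<bar>det (Matrix.mat m m A)\<bar> \<le> (\<Sum>\<pi>\<in>?S. \<bar>signof \<pi> * (\<Prod>i = 0..<m. Matrix.mat m m A $$ (i, \<pi> i))\<bar>)"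
    by (simp only: sum_abs)
  also have "\<dots> \<le> (\<Sum>\<pi>\<in>?S. c ^ m)"
  proof (rule sum_mono)
    fix \<pi> assume "\<pi> \<in> ?S"
    then have \<pi>: "\<pi> i < m" if "i < m" for i using that permutes_in_image[of \<pi> "{0..<m}" i] by auto
    have "\<bar>\<Prod>i = 0..<m. Matrix.mat m m A $$ (i, \<pi> i)\<bar> = (\<Prod>i = 0..<m. \<bar>A (i, \<pi> i)\<bar>)"
      unfolding abs_prod using \<pi> by (intro prod.cong) auto
    also have "\<dots> \<le> (\<Prod>i = 0..<m. c)" using assms \<pi> by (intro prod_mono) auto
    finally show "\<bar>signof \<pi> * (\<Prod>i = 0..<m. Matrix.mat m m A $$ (i, \<pi> i))\<bar> \<le> c ^ m"
      by (simp add: abs_mult sign_def)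
  qed
  also have "\<dots> = fact m * c ^ m" by (simp add: card_permutations)
  finally show ?thesis .
qed

lemma prod_primes_dvd:
  fixes N :: nat
  assumes "finite F" "\<And>p. p \<in> F \<Longrightarrow> prime p" "\<And>p. p \<in> F \<Longrightarrow> p dvd N"
  shows "\<Prod>F dvd N"
  using assms
proof (induction F rule: finite_induct)
  case (insert p F)
  have "coprime p (\<Prod>F)"
    using insert.prems(1) insert.hyps by (intro prod_coprime_right) (metis insertCI primes_coprime)
  then show ?case using insert by (simp add: divides_mult)
qed simp

text \<open>The product of these prime divisors divides \<open>D\<close>, while each of them exceeds \<open>K\<close>.\<close>

lemma card_large_prime_divisors:
  fixes D :: int
  assumes "D \<noteq> 0" "K > 1" "\<bar>D\<bar> < int K ^ Suc m" 
  shows "finite {p. prime p \<and> K < p \<and> int p dvd D}" (is "finite ?F")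
    and "card {p. prime p \<and> K < p \<and> int p dvd D} \<le> m"
proof -
  have "?F \<subseteq> {p. p dvd nat \<bar>D\<bar>}" by (auto simp: int_dvd_int_iff[symmetric])
  moreover have "finite {p. p dvd nat \<bar>D\<bar>}" using assms(1) by (intro finite_divisors_nat) auto
  ultimately show fin: "finite ?F" by (rule finite_subset)
  have "\<Prod>?F dvd nat \<bar>D\<bar>"
    by (rule prod_primes_dvd[OF fin]) (auto simp: int_dvd_int_iff[symmetric])
  then have "\<Prod>?F \<le> nat \<bar>D\<bar>" using assms(1) by (intro dvd_imp_le) auto
  moreover have "K ^ card ?F \<le> \<Prod>?F"
    using prod_mono[of ?F "\<lambda>_. K" "\<lambda>p. p"] by auto
  ultimately have "K ^ card ?F \<le> nat \<bar>D\<bar>" by linarith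
  also have "\<dots> < K ^ Suc m" using assms(3) by (simp add: nat_less_iff)
  finally show "card ?F \<le> m" using assms(2) by (metis less_Suc_eq_le power_less_imp_less_exp)
qed

text \<open>With all other entries of the row fixed, the entry at a position with invertible coefficient is
  determined modulo \<open>p\<close>.\<close>

lemma prob_row_hyperplane_le:
  assumes p: "prime p" and j: "j\<^sub>0 < m" "\<not> int p dvd v j\<^sub>0"
    and q: "\<And>r. measure_pmf.prob b {x. [x = r] (mod int p)} \<le> q"
  shows "measure_pmf.prob (iid ({a} \<times> {..<m}) b) {g. int p dvd (\<Sum>j<m. g (a, j) * v j)} \<le> q"
proof -
  let ?I = "{a} \<times> ({..<m} - {j\<^sub>0})" and ?J = "{(a, j\<^sub>0)}"
  let ?E = "{g :: nat \<times> nat \<Rightarrow> int. int p dvd (\<Sum>j<m. g (a, j) * v j)}"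
  have "coprime (v j\<^sub>0) (int p)"
    using p j by (metis coprime_commute prime_imp_coprime prime_nat_int_transfer)
  then obtain u where u: "[v j\<^sub>0 * u = 1] (mod int p)" using cong_solve_coprime_int by blast
  have "measure_pmf.prob (iid (?I \<union> ?J) b) ?E \<le> q"
  proof (rule prob_iid_Un_le)
    fix f :: "nat \<times> nat \<Rightarrow> int"
    define s where "s = (\<Sum>j\<in>{..<m} - {j\<^sub>0}. f (a, j) * v j)"
    have "{g. merge ?I f g \<in> ?E} \<subseteq> Pi ?J (\<lambda>_. {x. [x = - s * u] (mod int p)})"
    proof
      fix g assume "g \<in> {g. merge ?I f g \<in> ?E}"
      then have "int p dvd (\<Sum>j<m. merge ?I f g (a, j) * v j)" by simp
      also have "(\<Sum>j<m. merge ?I f g (a, j) * v j) = g (a, j\<^sub>0) * v j\<^sub>0 + s"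
      proof -
        have "(\<Sum>j<m. merge ?I f g (a, j) * v j) =
            merge ?I f g (a, j\<^sub>0) * v j\<^sub>0 + (\<Sum>j\<in>{..<m} - {j\<^sub>0}. merge ?I f g (a, j) * v j)"
          using j by (intro sum.remove) auto
        also have "(\<Sum>j\<in>{..<m} - {j\<^sub>0}. merge ?I f g (a, j) * v j) = s"
          unfolding s_def by (intro sum.cong) auto
        finally show ?thesis by simp
      qed
      finally have "[(g (a, j\<^sub>0) * v j\<^sub>0 + s) * u = 0 * u] (mod int p)"
        by (intro cong_mult cong_refl) (simp add: cong_0_iff)
      then have "[g (a, j\<^sub>0) * (v j\<^sub>0 * u) = - s * u] (mod int p)"
        by (simp add: cong_iff_dvd_diff algebra_simps)
      moreover have "[g (a, j\<^sub>0) * (v j\<^sub>0 * u) = g (a, j\<^sub>0) * 1] (mod int p)"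
        by (intro cong_mult cong_refl u)
      ultimately have "[g (a, j\<^sub>0) = - s * u] (mod int p)"
        by (metis cong_sym cong_trans mult.right_neutral)
      then show "g \<in> Pi ?J (\<lambda>_. {x. [x = - s * u] (mod int p)})" by simp
    qed
    then have "measure_pmf.prob (iid ?J b) {g. merge ?I f g \<in> ?E} \<le>
        measure_pmf.prob (iid ?J b) (Pi ?J (\<lambda>_. {x. [x = - s * u] (mod int p)}))"
      by (intro measure_pmf.finite_measure_mono) auto
    also have "\<dots> \<le> q" by (subst measure_Pi_pmf_Pi) (simp_all add: q)
    finally show "measure_pmf.prob (iid ?J b) {g. merge ?I f g \<in> ?E} \<le> q" .
  qed auto
  moreover have "?I \<union> ?J = {a} \<times> {..<m}" using j by auto
  ultimately show ?thesis by simp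
qed

text \<open>If the first \<open>m\<close> columns are independent modulo \<open>p\<close>, then the kernel of the first \<open>Suc m\<close> columns has
  dimension at most one: the combination of \<open>v\<close> and \<open>w\<close> whose last coordinate is eliminated is a
  dependence of the first \<open>m\<close> columns, hence zero.  Therefore a row orthogonal to the nonzero kernel vector
  \<open>w\<close> is orthogonal to every other kernel vector.\<close>

lemma kernel_mod_prime_is_line:
  fixes A :: "nat \<times> nat \<Rightarrow> int"
  assumes p: "prime p" and A: "\<not> rank_deficient p n m A"
    and v: "\<And>i. i < n \<Longrightarrow> int p dvd (\<Sum>j<Suc m. A (i, j) * v j)"
    and w: "\<And>i. i < n \<Longrightarrow> int p dvd (\<Sum>j<Suc m. A (i, j) * w j)" "\<exists>j<Suc m. \<not> int p dvd w j"
    and x: "int p dvd (\<Sum>j<Suc m. x j * w j)"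
  shows "int p dvd (\<Sum>j<Suc m. x j * v j)"
proof -
  have nz: "\<not> int p dvd w m"
  proof
    assume d: "int p dvd w m"
    then obtain j where j: "j < m" "\<not> int p dvd w j" using w(2) by (auto simp: less_Suc_eq)
    have "int p dvd (\<Sum>j<m. A (i, j) * w j)" if "i < n" for i
      using w(1)[OF that] d by (simp add: dvd_add_left_iff)
    with A j show False using rank_deficientI by blast
  qed
  define u where "u j = w m * v j - v m * w j" for j
  have um: "u m = 0" by (simp add: u_def)
  have comb: "(\<Sum>j<m. y j * u j) = w m * (\<Sum>j<Suc m. y j * v j) - v m * (\<Sum>j<Suc m. y j * w j)" for y
  proof -
    have "(\<Sum>j<m. y j * u j) = (\<Sum>j<Suc m. y j * u j)" by (simp add: um)
    also have "\<dots> = w m * (\<Sum>j<Suc m. y j * v j) - v m * (\<Sum>j<Suc m. y j * w j)"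
      unfolding u_def sum_distrib_left sum_subtractf[symmetric] by (intro sum.cong) (auto simp: algebra_simps)
    finally show ?thesis .
  qed
  have u: "int p dvd u j" if "j < m" for j
  proof (rule ccontr)
    assume "\<not> int p dvd u j"
    moreover have "int p dvd (\<Sum>j<m. A (i, j) * u j)" if "i < n" for i
      unfolding comb[of "\<lambda>j. A (i, j)"] using v[OF that] w(1)[OF that] by (intro dvd_diff dvd_mult)
    ultimately show False using A \<open>j < m\<close> rank_deficientI[of j m p u n A] by blast
  qed
  have "int p dvd (\<Sum>j<m. x j * u j)" using u by (intro dvd_sum dvd_mult) auto
  then have "int p dvd w m * (\<Sum>j<Suc m. x j * v j)"
    unfolding comb using dvd_mult[OF x, of "v m"] by (metis diff_add_cancel dvd_add)
  with nz p show ?thesis by (metis prime_dvd_mult_iff prime_nat_int_transfer)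
qed

lemma sum_inverse_squares_le:
  assumes "B > 0" "B \<le> L"
  shows "(\<Sum>p\<in>{B<..L}. 1 / real p ^ 2) \<le> 1 / real B - 1 / real L"
  using assms(2)
proof (induction L rule: dec_induct)
  case (step L)
  have "{B<..Suc L} = insert (Suc L) {B<..L}" using step by auto
  then have "(\<Sum>p\<in>{B<..Suc L}. 1 / real p ^ 2) = 1 / real (Suc L) ^ 2 + (\<Sum>p\<in>{B<..L}. 1 / real p ^ 2)"
    by simp
  also have "1 / real (Suc L) ^ 2 \<le> 1 / (real L * real (Suc L))"
    using assms(1) step by (intro divide_left_mono) (auto simp: power2_eq_square)
  also have "\<dots> = 1 / real L - 1 / real (Suc L)"
    using assms(1) step by (simp add: field_simps)
  finally show ?case using step.IH by linarith
qed simp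

text \<open>The dominant term of the column count is the one of the last column.\<close>

lemma prob_box_rank_deficient_le:
  assumes p: "prime p" "p \<le> 2 * k + 1" and n: "n = m + d"
  shows "measure_pmf.prob (iid ({..<n} \<times> {..<m}) (unif_box k)) {A. rank_deficient p n m A}
    \<le> real m * 2 ^ n / real p ^ Suc d"
proof -
  have p0: "real p \<ge> 1" using p prime_ge_1_nat by simp
  have "measure_pmf.prob (iid ({..<n} \<times> {..<m}) (unif_box k)) {A. rank_deficient p n m A}
      \<le> (\<Sum>j<m. real p ^ j * (2 / real p) ^ n)"
    using p by (intro prob_rank_deficient_le prob_unif_box_cong_le) (auto simp: prime_gt_0_nat)
  also have "\<dots> \<le> (\<Sum>j<m. 2 ^ n / real p ^ Suc d)"
  proof (rule sum_mono)
    fix j assume "j \<in> {..<m}"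
    then have "real p ^ (j + Suc d) \<le> real p ^ n" using p0 n by (intro power_increasing) auto
    then show "real p ^ j * (2 / real p) ^ n \<le> 2 ^ n / real p ^ Suc d"
      using p0 by (simp add: power_divide field_simps power_add)
  qed
  finally show ?thesis by simp
qed

text \<open>Here the codimension two of the deficient matrices enters: the series of \<open>1/p^2\<close> converges.\<close>

lemma prob_box_rank_deficient_midsize_le:
  assumes "B > 0"
  shows "measure_pmf.prob (iid ({..<Suc m} \<times> {..<m}) (unif_box k))
      {A. \<exists>p\<in>{B<..2 * k + 1}. prime p \<and> rank_deficient p (Suc m) m A} \<le> real m * 2 ^ Suc m / real B"
proof (cases "B \<le> 2 * k + 1")
  case True
  let ?\<mu> = "measure_pmf.prob (iid ({..<Suc m} \<times> {..<m}) (unif_box k))"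
  let ?F = "{p \<in> {B<..2 * k + 1}. prime p}"
  have "{A. \<exists>p\<in>{B<..2 * k + 1}. prime p \<and> rank_deficient p (Suc m) m A} =
      (\<Union>p\<in>?F. {A. rank_deficient p (Suc m) m A})" by auto
  then have "?\<mu> {A. \<exists>p\<in>{B<..2 * k + 1}. prime p \<and> rank_deficient p (Suc m) m A} \<le>
      (\<Sum>p\<in>?F. ?\<mu> {A. rank_deficient p (Suc m) m A})"
    by (simp only:) (rule measure_pmf.finite_measure_subadditive_finite, auto)
  also have "\<dots> \<le> (\<Sum>p\<in>?F. real m * 2 ^ Suc m * (1 / real p ^ 2))"
  proof (rule sum_mono)
    fix p assume "p \<in> ?F"
    then show "?\<mu> {A. rank_deficient p (Suc m) m A} \<le> real m * 2 ^ Suc m * (1 / real p ^ 2)"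
      using prob_box_rank_deficient_le[of p k "Suc m" m 1] by (simp add: numeral_2_eq_2)
  qed
  also have "\<dots> \<le> (\<Sum>p\<in>{B<..2 * k + 1}. real m * 2 ^ Suc m * (1 / real p ^ 2))"
    by (rule sum_mono2) auto
  also have "\<dots> = real m * 2 ^ Suc m * (\<Sum>p\<in>{B<..2 * k + 1}. 1 / real p ^ 2)"
    by (rule sum_distrib_left[symmetric])
  also have "\<dots> \<le> real m * 2 ^ Suc m * (1 / real B)"
    using sum_inverse_squares_le[OF assms True] by (intro mult_left_mono) (auto intro: order_trans)
  finally show ?thesis by simp
next
  case False
  then have *: "{A. \<exists>p\<in>{B<..2 * k + 1}. prime p \<and> rank_deficient p (Suc m) m A} = {}" by auto
  show ?thesis unfolding * by simp
qed

text \<open>A singular integral matrix is singular modulo every prime, which for a fixed large prime \<open>p\<close>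
  already has probability \<open>O(1/p)\<close>.\<close>

lemma prob_box_det_0_tendsto:
  "(\<lambda>k. measure_pmf.prob (iid ({..<m} \<times> {..<m}) (unif_box k)) {A. det (Matrix.mat m m A) = 0}) \<longlonglongrightarrow> 0"
proof (rule LIMSEQ_I)
  fix e :: real assume e: "e > 0"
  \<comment> \<open>The prime is fixed before \<open>k\<close>, so that it is below the box size for all large \<open>k\<close>.\<close>
  obtain M where M: "real m * 2 ^ m / e < real M" using reals_Archimedean2 by blast
  obtain p where p: "prime p" "p > M" using bigger_prime by blast
  have "real m * 2 ^ m / real p < e"
  proof -
    have "real m * 2 ^ m / e < real p" using M p by linarith
    then show ?thesis using e p(2) by (simp add: field_simps)
  qed
  moreover have "measure_pmf.prob (iid ({..<m} \<times> {..<m}) (unif_box k)) {A. det (Matrix.mat m m A) = 0}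
      \<le> real m * 2 ^ m / real p" if "k \<ge> p" for k
  proof -
    have "measure_pmf.prob (iid ({..<m} \<times> {..<m}) (unif_box k)) {A. det (Matrix.mat m m A) = 0} \<le>
        measure_pmf.prob (iid ({..<m} \<times> {..<m}) (unif_box k)) {A. rank_deficient p m m A}"
      using det_0_imp_rank_deficient[OF p(1)] by (intro measure_pmf.finite_measure_mono) auto
    also have "\<dots> \<le> real m * 2 ^ m / real p"
      using prob_box_rank_deficient_le[of p k m m 0] p(1) that by simp
    finally show ?thesis .
  qed
  ultimately show "\<exists>k0. \<forall>k\<ge>k0. norm (measure_pmf.prob (iid ({..<m} \<times> {..<m}) (unif_box k))
      {A. det (Matrix.mat m m A) = 0} - 0) < e"
    by (intro exI[of _ p]) (auto intro: order_le_less_trans)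
qed

text \<open>The event \<open>E k\<close> is the case in which deficiency modulo a large prime is caused by the last column and is
  not due to a vanishing determinant.  With the square block \<open>f\<close> fixed, the relevant primes are
  divisors of its determinant, at most \<open>Suc m\<close> in number, and for each of them the last row has to
  be orthogonal to a kernel vector that depends only on \<open>f\<close>.\<close>

lemma prob_box_new_deficiency_le:
  fixes m :: nat
  defines "E \<equiv> \<lambda>k. {A. det (Matrix.mat (Suc m) (Suc m) A) \<noteq> 0 \<and> (\<exists>p>2 * k + 1. prime p \<and>
       \<not> rank_deficient p (Suc m) m A \<and> rank_deficient p (Suc (Suc m)) (Suc m) A)}"
  assumes k: "fact (Suc m) \<le> 2 * k + 1" "k > 0"
  shows "measure_pmf.prob (iid ({..<Suc (Suc m)} \<times> {..<Suc m}) (unif_box k)) (E k) \<le> real (Suc m) / real (2 * k + 1)"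
proof -
  let ?K = "2 * k + 1"
  let ?I = "{..<Suc m} \<times> {..<Suc m}" and ?J = "{Suc m} \<times> {..<Suc m}"
  have "measure_pmf.prob (iid (?I \<union> ?J) (unif_box k)) (E k) \<le> real (Suc m) / real ?K"
  proof (rule prob_iid_Un_le)
    fix f assume f: "f \<in> set_pmf (iid ?I (unif_box k))"
    have fk: "\<bar>f (i, j)\<bar> \<le> int k" if "i < Suc m" "j < Suc m" for i j
    proof -
      have "f (i, j) \<in> {- int k..int k}"
        using f that by (simp add: set_Pi_pmf PiE_dflt_def)
      then show ?thesis by auto
    qed
    let ?D = "det (Matrix.mat (Suc m) (Suc m) f)"
    have merge_mat: "Matrix.mat (Suc m) (Suc m) (merge ?I f g) = Matrix.mat (Suc m) (Suc m) f" for g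
      by (intro eq_matI) auto
    have merge_rd: "rank_deficient p (Suc m) c (merge ?I f g) = rank_deficient p (Suc m) c f"
      if "c \<le> Suc m" for p c g
      by (rule rank_deficient_cong) (use that in auto)
    show "measure_pmf.prob (iid ?J (unif_box k)) {g. merge ?I f g \<in> E k} \<le> real (Suc m) / real ?K"
    proof (cases "?D = 0")
      case True
      then have "{g. merge ?I f g \<in> E k} = {}" by (auto simp: E_def merge_mat)
      then show ?thesis by simp
    next
      case False
      define F where "F = {p. prime p \<and> ?K < p \<and> int p dvd ?D}"
      have "\<bar>?D\<bar> \<le> fact (Suc m) * int k ^ Suc m" by (rule abs_det_le) (rule fk)
      also have "\<dots> \<le> int ?K * int k ^ Suc m"
      proof (rule mult_right_mono)
        have "int (fact (Suc m)) \<le> int ?K" using k(1) by (simp only: of_nat_le_iff)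
        then show "(fact (Suc m) :: int) \<le> int ?K" by (simp only: of_nat_fact)
      qed simp
      also have "\<dots> < int ?K * int ?K ^ Suc m"
        using k(2) by (intro mult_strict_left_mono power_strict_mono) auto
      finally have Dlt: "\<bar>?D\<bar> < int ?K ^ Suc (Suc m)" by simp
      have F: "finite F" "card F \<le> Suc m"
        using card_large_prime_divisors[OF False _ Dlt] k(2) by (simp_all add: F_def)
      define G where "G = {p \<in> F. \<not> rank_deficient p (Suc m) m f \<and> rank_deficient p (Suc m) (Suc m) f}"
      have "\<forall>p\<in>G. \<exists>v. (\<exists>j<Suc m. \<not> int p dvd v j) \<and> (\<forall>i<Suc m. int p dvd (\<Sum>j<Suc m. f (i, j) * v j))"
        unfolding G_def rank_deficient_def by blast
      then obtain v where v: "\<And>p. p \<in> G \<Longrightarrow> \<exists>j<Suc m. \<not> int p dvd v p j"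
        "\<And>p i. p \<in> G \<Longrightarrow> i < Suc m \<Longrightarrow> int p dvd (\<Sum>j<Suc m. f (i, j) * v p j)"
        unfolding bchoice_iff by blast
      let ?H = "\<lambda>p. {g. int p dvd (\<Sum>j<Suc m. g (Suc m, j) * v p j)}"
      have sub: "{g. merge ?I f g \<in> E k} \<subseteq> (\<Union>p\<in>G. ?H p)"
      proof
        fix g assume "g \<in> {g. merge ?I f g \<in> E k}"
        then obtain p where p: "p > ?K" "prime p" "\<not> rank_deficient p (Suc m) m f"
          "rank_deficient p (Suc (Suc m)) (Suc m) (merge ?I f g)"
          by (auto simp: E_def merge_rd)
        have "rank_deficient p (Suc m) (Suc m) f"
          using rank_deficient_fewer_rows[OF p(4), of "Suc m"] merge_rd[of "Suc m"] by simp
        with p rank_deficient_imp_dvd_det have pG: "p \<in> G" unfolding G_def F_def by simp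
        obtain w where w: "\<exists>j<Suc m. \<not> int p dvd w j"
          "\<And>i. i < Suc (Suc m) \<Longrightarrow> int p dvd (\<Sum>j<Suc m. merge ?I f g (i, j) * w j)"
          using p(4) unfolding rank_deficient_def by blast
        have "int p dvd (\<Sum>j<Suc m. g (Suc m, j) * v p j)"
        proof (rule kernel_mod_prime_is_line[OF p(2,3) v(2)[OF pG] _ w(1)])
          show "int p dvd (\<Sum>j<Suc m. f (i, j) * w j)" if "i < Suc m" for i
          proof -
            have "(\<Sum>j<Suc m. merge ?I f g (i, j) * w j) = (\<Sum>j<Suc m. f (i, j) * w j)"
              using that by (intro sum.cong) auto
            then show ?thesis using w(2)[of i] that by simp
          qed
          have "(\<Sum>j<Suc m. merge ?I f g (Suc m, j) * w j) = (\<Sum>j<Suc m. g (Suc m, j) * w j)"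
            by (intro sum.cong) auto
          then show "int p dvd (\<Sum>j<Suc m. g (Suc m, j) * w j)" using w(2)[of "Suc m"] by simp
        qed
        with pG show "g \<in> (\<Union>p\<in>G. ?H p)" by blast
      qed
      have G: "finite G" "card G \<le> Suc m"
        using F card_mono[of F G] by (auto simp: G_def)
      have "measure_pmf.prob (iid ?J (unif_box k)) {g. merge ?I f g \<in> E k} \<le>
          measure_pmf.prob (iid ?J (unif_box k)) (\<Union>p\<in>G. ?H p)"
        using sub by (intro measure_pmf.finite_measure_mono) auto
      also have "\<dots> \<le> (\<Sum>p\<in>G. measure_pmf.prob (iid ?J (unif_box k)) (?H p))"
        using G by (intro measure_pmf.finite_measure_subadditive_finite) auto
      also have "\<dots> \<le> (\<Sum>p\<in>G. 1 / real ?K)"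
      proof (rule sum_mono)
        fix p assume p: "p \<in> G"
        obtain j where j: "j < Suc m" "\<not> int p dvd v p j" using v(1)[OF p] by blast
        have "prime p" "p > ?K" using p by (auto simp: G_def F_def)
        then show "measure_pmf.prob (iid ?J (unif_box k)) (?H p) \<le> 1 / real ?K"
          using j by (intro prob_row_hyperplane_le prob_unif_box_cong_le_large) auto
      qed
      also have "\<dots> = real (card G) / real ?K" by simp
      also have "\<dots> \<le> real (Suc m) / real ?K"
        using G(2) by (intro divide_right_mono) (simp_all only: of_nat_le_iff of_nat_0_le_iff)
      finally show ?thesis .
    qed
  qed auto
  moreover have "?I \<union> ?J = {..<Suc (Suc m)} \<times> {..<Suc m}" by (auto simp: less_Suc_eq)
  ultimately show ?thesis by simp
qed

text \<open>The uniform estimate for large primes.  The event for \<open>Suc m\<close> columns is covered by four: deficiency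
  without the last row and column (induction hypothesis), a prime of at most the size of the box,
  a vanishing determinant of the square block on top, and the event of the previous lemma.  Each
  receives a quarter of \<open>e\<close>.\<close>

lemma large_primes_negligible:
  assumes "e > 0"
  shows "\<exists>B. \<forall>\<^sub>F k in sequentially. measure_pmf.prob (iid ({..<Suc m} \<times> {..<m}) (unif_box k))
    {A. \<exists>p>B. prime p \<and> rank_deficient p (Suc m) m A} \<le> e"
  using assms
proof (induction m arbitrary: e)
  case 0
  then show ?case by (simp add: rank_deficient_def)
next
  case (Suc m)
  let ?J = "{..<Suc (Suc m)} \<times> {..<Suc m}"
  let ?\<mu> = "\<lambda>k. measure_pmf.prob (iid ?J (unif_box k))"
  let ?n = "Suc (Suc m)" and ?m = "Suc m"
  from Suc.IH[of "e / 4"] Suc.prems obtain B0 where B0: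
    "\<forall>\<^sub>F k in sequentially. measure_pmf.prob (iid ({..<?m} \<times> {..<m}) (unif_box k))
       {A. \<exists>p>B0. prime p \<and> rank_deficient p ?m m A} \<le> e / 4" by auto
  obtain M where M: "real ?m * 2 ^ ?n / (e / 4) < real M" using reals_Archimedean2 by blast
  \<comment> \<open>Above \<open>B0\<close> for the induction hypothesis, above \<open>M\<close> for the primes of at most the box size.\<close>
  define B where "B = Suc (max B0 M)"
  have B: "B > 0" "B > B0" "real ?m * 2 ^ ?n / real B \<le> e / 4"
  proof -
    have "real ?m * 2 ^ ?n / (e / 4) < real B" using M by (simp add: B_def)
    then show "real ?m * 2 ^ ?n / real B \<le> e / 4"
      using Suc.prems by (simp add: B_def field_simps)
  qed (auto simp: B_def)
  let ?E1 = "{A. \<exists>p>B0. prime p \<and> rank_deficient p ?m m A}"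
  let ?E2 = "\<lambda>k. {A. \<exists>p\<in>{B<..2 * k + 1}. prime p \<and> rank_deficient p ?n ?m A}"
  let ?E3 = "{A. det (Matrix.mat ?m ?m A) = 0}"
  let ?E4 = "\<lambda>k. {A. det (Matrix.mat ?m ?m A) \<noteq> 0 \<and> (\<exists>p>2 * k + 1. prime p \<and>
       \<not> rank_deficient p ?m m A \<and> rank_deficient p ?n ?m A)}"
  have sub: "{A. \<exists>p>B. prime p \<and> rank_deficient p ?n ?m A} \<subseteq> ?E1 \<union> ?E2 k \<union> ?E3 \<union> ?E4 k" for k
  proof
    fix A assume "A \<in> {A. \<exists>p>B. prime p \<and> rank_deficient p ?n ?m A}"
    then obtain p where p: "p > B" "prime p" "rank_deficient p ?n ?m A" by blast
    consider "p \<in> {B<..2 * k + 1}" | "p > B0" "rank_deficient p ?m m A"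
      | "p > 2 * k + 1" "\<not> rank_deficient p ?m m A"
      using p(1) B(2) by fastforce
    then show "A \<in> ?E1 \<union> ?E2 k \<union> ?E3 \<union> ?E4 k" using p by cases blast+
  qed
  have E1: "?\<mu> k ?E1 = measure_pmf.prob (iid ({..<?m} \<times> {..<m}) (unif_box k)) ?E1" for k
  proof (rule prob_iid_subset)
    fix A A' :: "nat \<times> nat \<Rightarrow> int"
    assume "\<And>x. x \<in> {..<?m} \<times> {..<m} \<Longrightarrow> A x = A' x"
    then have "rank_deficient p ?m m A = rank_deficient p ?m m A'" for p
      by (intro rank_deficient_cong) auto
    then show "(\<exists>p>B0. prime p \<and> rank_deficient p ?m m A) = (\<exists>p>B0. prime p \<and> rank_deficient p ?m m A')"
      by simp
  qed auto
  have E2: "?\<mu> k (?E2 k) \<le> e / 4" for k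
    using prob_box_rank_deficient_midsize_le[OF B(1), where m = ?m and k = k] B(3) by linarith
  have E3: "?\<mu> k ?E3 = measure_pmf.prob (iid ({..<?m} \<times> {..<?m}) (unif_box k)) ?E3" for k
  proof (rule prob_iid_subset)
    fix A A' :: "nat \<times> nat \<Rightarrow> int"
    assume "\<And>x. x \<in> {..<?m} \<times> {..<?m} \<Longrightarrow> A x = A' x"
    then have "Matrix.mat ?m ?m A = Matrix.mat ?m ?m A'" by (intro eq_matI) auto
    then show "(det (Matrix.mat ?m ?m A) = 0) = (det (Matrix.mat ?m ?m A') = 0)" by simp
  qed auto
  have "\<forall>\<^sub>F k in sequentially. ?\<mu> k ?E3 < e / 4"
    unfolding E3 using Suc.prems by (intro order_tendstoD(2)[OF prob_box_det_0_tendsto]) auto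
  moreover have "(\<lambda>k. real ?m / real (2 * k + 1)) \<longlonglongrightarrow> 0" by real_asymp
  then have "\<forall>\<^sub>F k in sequentially. real ?m / real (2 * k + 1) < e / 4"
    using Suc.prems by (intro order_tendstoD(2)[where y = 0]) auto
  ultimately have "\<forall>\<^sub>F k in sequentially. ?\<mu> k {A. \<exists>p>B. prime p \<and> rank_deficient p ?n ?m A} \<le> e"
    using B0 eventually_ge_at_top[of "fact ?m :: nat"]
  proof eventually_elim
    case (elim k)
    have "(fact ?m :: nat) \<ge> 1" by (rule fact_ge_1)
    then have k: "fact ?m \<le> 2 * k + 1" "k > 0" using elim(4) by linarith+
    have "?\<mu> k {A. \<exists>p>B. prime p \<and> rank_deficient p ?n ?m A} \<le> ?\<mu> k (?E1 \<union> ?E2 k \<union> ?E3 \<union> ?E4 k)"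
      by (intro measure_pmf.finite_measure_mono sub) auto
    also have "\<dots> \<le> ?\<mu> k ?E1 + ?\<mu> k (?E2 k) + ?\<mu> k ?E3 + ?\<mu> k (?E4 k)"
      by (intro order_trans[OF measure_Un_le] add_mono order_refl) auto
    finally show ?case
      using elim E1[of k] E2[of k] prob_box_new_deficiency_le[OF k] by linarith
  qed
  then show ?case by blast
qed

section \<open>Euler product and limits of products of zeta values\<close>

lemma zeta_summable:
  assumes "s > 1" shows "summable (\<lambda>k. 1 / real (Suc k) powr s)"
proof -
  have "summable (\<lambda>k. 1 / real k powr s)"
    using summable_real_powr_iff[of "- s"] assms by (simp add: powr_minus_divide)
  then show ?thesis by (subst summable_Suc_iff)
qed

text \<open>The terms of the Dirichlet series of zeta that survive sieving out the multiples of the primes in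
  \<open>F\<close>.  The \<open>k\<close>-th term belongs to the integer \<open>Suc k\<close>.\<close>

definition coprime_term :: "real \<Rightarrow> nat set \<Rightarrow> nat \<Rightarrow> real" where
  "coprime_term s F k = (if \<forall>p\<in>F. \<not> p dvd Suc k then 1 / real (Suc k) powr s else 0)"

lemma coprime_term_summable:
  assumes "s > 1" shows "summable (coprime_term s F)"
  by (rule summable_comparison_test'[OF zeta_summable[OF assms], of 0]) (auto simp: coprime_term_def)

text \<open>Eratosthenes' sieve: multiplying by \<open>1 - 1 / p powr s\<close> removes the terms at multiples of \<open>p\<close>, since
  the series over the multiples of \<open>p\<close> is the series itself scaled by \<open>1 / p powr s\<close>.\<close>

lemma zeta_sieve:
  assumes s: "s > 1" and F: "finite F" "\<And>p. p \<in> F \<Longrightarrow> prime p"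
  shows "zeta s * (\<Prod>p\<in>F. 1 - 1 / real p powr s) = (\<Sum>k. coprime_term s F k)"
  using F
proof (induction F rule: finite_induct)
  case empty
  show ?case by (simp add: zeta_def coprime_term_def)
next
  case (insert p F)
  have p: "prime p" using insert.prems by simp
  hence p0: "p > 0" by (simp add: prime_gt_0_nat)
  \<comment> \<open>The index of the term that belongs to \<open>p * Suc k\<close>.\<close>
  define h where "h k = p * Suc k - 1" for k
  have Sh: "Suc (h k) = p * Suc k" for k using p0 by (simp add: h_def)
  have ndvd: "q dvd p * Suc k \<longleftrightarrow> q dvd Suc k" if "q \<in> F" for q k
  proof -
    have q: "prime q" using that insert.prems by simp
    hence "\<not> q dvd p" using p that insert.hyps by (metis primes_dvd_imp_eq)
    thus ?thesis using q by (metis prime_dvd_mult_iff)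
  qed
  let ?d = "\<lambda>k. if p dvd Suc k then coprime_term s F k else 0"
  have hf: "(\<lambda>k. coprime_term s F (h k)) = (\<lambda>k. 1 / real p powr s * coprime_term s F k)"
    using ndvd p0 by (auto simp: coprime_term_def Sh powr_mult fun_eq_iff simp del: mult_Suc_right of_nat_Suc)
  have hd: "?d k = 0" if "k \<notin> range h" for k
  proof (cases "p dvd Suc k")
    case True
    then obtain c where c: "Suc k = p * c" by (rule dvdE)
    hence "c > 0" by (cases c) auto
    then obtain c' where "c = Suc c'" by (cases c) auto
    hence "k = h c'" using c Sh[of c'] by simp
    with that show ?thesis by blast
  qed auto
  have dsum: "summable ?d"
    by (rule summable_comparison_test'[OF coprime_term_summable[OF s, of F], of 0])
       (auto simp: coprime_term_def)
  have mono: "strict_mono h" using p0 by (auto simp: strict_mono_def h_def intro!: diff_less_mono)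
  have "(\<Sum>k. ?d (h k)) = (\<Sum>k. ?d k)"
    by (rule suminf_mono_reindex[OF mono hd])
  hence "(\<Sum>k. ?d k) = (\<Sum>k. coprime_term s F (h k))" by (simp add: Sh del: mult_Suc_right)
  also have "\<dots> = 1 / real p powr s * (\<Sum>k. coprime_term s F k)"
    unfolding hf by (rule suminf_mult[OF coprime_term_summable[OF s]])
  finally have d: "(\<Sum>k. ?d k) = 1 / real p powr s * (\<Sum>k. coprime_term s F k)" .
  have "(\<Sum>k. coprime_term s (insert p F) k) = (\<Sum>k. coprime_term s F k - ?d k)"
    by (intro suminf_cong) (auto simp: coprime_term_def)
  also have "\<dots> = (\<Sum>k. coprime_term s F k) - (\<Sum>k. ?d k)"
    by (rule suminf_diff[symmetric, OF coprime_term_summable[OF s] dsum])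
  also have "\<dots> = (\<Sum>k. coprime_term s F k) * (1 - 1 / real p powr s)"
    unfolding d by (simp add: algebra_simps)
  finally show ?case using insert by (simp add: mult_ac)
qed

lemma zeta_ge_1:
  assumes "s > 1" shows "zeta s \<ge> 1"
  using sum_le_suminf[OF zeta_summable[OF assms], of "{0}"] by (simp add: zeta_def)

text \<open>After sieving by all primes up to \<open>B\<close>, the first term is \<open>1\<close> and the next surviving one lies beyond \<open>B\<close>,
  so the rest is bounded by a tail of the series.\<close>

lemma euler_product:
  assumes s: "s > 1"
  shows "(\<lambda>B. \<Prod>p | prime p \<and> p \<le> B. 1 - 1 / real p powr s) \<longlonglongrightarrow> 1 / zeta s"
proof -
  let ?P = "\<lambda>B. {p::nat. prime p \<and> p \<le> B}"
  let ?f = "\<lambda>k. 1 / real (Suc k) powr s"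
  have low: "1 \<le> (\<Sum>k. coprime_term s (?P B) k)" for B
  proof -
    have "sum (coprime_term s (?P B)) {0} \<le> (\<Sum>k. coprime_term s (?P B) k)"
      by (rule sum_le_suminf[OF coprime_term_summable[OF s]]) (auto simp: coprime_term_def)
    moreover have "coprime_term s (?P B) 0 = 1" by (auto simp: coprime_term_def)
    ultimately show ?thesis by simp
  qed
  have up: "(\<Sum>k. coprime_term s (?P B) k) \<le> 1 + (\<Sum>k. ?f (k + B))" if "B > 0" for B
  proof -
    have z: "coprime_term s (?P B) k = 0" if "0 < k" "k < B" for k
    proof -
      obtain p where p: "prime p" "p dvd Suc k" using prime_factor_nat[of "Suc k"] \<open>0 < k\<close> by auto
      hence "p \<le> B" using that by (meson Suc_leI dvd_imp_le le_trans zero_less_Suc)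
      with p show ?thesis by (auto simp: coprime_term_def)
    qed
    have "(\<Sum>k. coprime_term s (?P B) k) = (\<Sum>k. coprime_term s (?P B) (k + B)) +
        (\<Sum>k<B. coprime_term s (?P B) k)"
      by (rule suminf_split_initial_segment[OF coprime_term_summable[OF s]])
    also have "(\<Sum>k<B. coprime_term s (?P B) k) = (\<Sum>k\<in>{0}. coprime_term s (?P B) k)"
      using z that by (intro sum.mono_neutral_right) auto
    also have "\<dots> = 1" by (auto simp: coprime_term_def)
    also have "(\<Sum>k. coprime_term s (?P B) (k + B)) \<le> (\<Sum>k. ?f (k + B))"
    proof (rule suminf_le)
      show "summable (\<lambda>k. coprime_term s (?P B) (k + B))"
        by (rule summable_ignore_initial_segment[OF coprime_term_summable[OF s]])
      show "summable (\<lambda>k. ?f (k + B))"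
        by (rule summable_ignore_initial_segment[OF zeta_summable[OF s]])
    qed (simp add: coprime_term_def)
    finally show ?thesis by simp
  qed
  have lim: "(\<lambda>B. 1 + (\<Sum>k. ?f (k + B))) \<longlonglongrightarrow> 1 + 0"
    by (intro tendsto_add tendsto_const suminf_exist_split2 zeta_summable s)
  have "(\<lambda>B. \<Sum>k. coprime_term s (?P B) k) \<longlonglongrightarrow> 1"
  proof (rule tendsto_sandwich)
    show "\<forall>\<^sub>F B in sequentially. 1 \<le> (\<Sum>k. coprime_term s (?P B) k)"
      using low by (rule always_eventually[OF allI])
    show "\<forall>\<^sub>F B in sequentially. (\<Sum>k. coprime_term s (?P B) k) \<le> 1 + (\<Sum>k. ?f (k + B))"
      using eventually_gt_at_top[of 0] by (rule eventually_mono) (rule up)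
    show "(\<lambda>B. 1 + (\<Sum>k. ?f (k + B))) \<longlonglongrightarrow> 1" using lim by simp
  qed (rule tendsto_const)
  then have "(\<lambda>B. (\<Sum>k. coprime_term s (?P B) k) / zeta s) \<longlonglongrightarrow> 1 / zeta s"
    using zeta_ge_1[OF s] by (intro tendsto_divide) auto
  moreover have "(\<Sum>k. coprime_term s (?P B) k) / zeta s = (\<Prod>p\<in>?P B. 1 - 1 / real p powr s)" for B
  proof -
    have "zeta s * (\<Prod>p\<in>?P B. 1 - 1 / real p powr s) = (\<Sum>k. coprime_term s (?P B) k)"
      by (rule zeta_sieve[OF s]) auto
    moreover have "zeta s \<noteq> 0" using zeta_ge_1[OF s] by linarith
    ultimately show ?thesis by (metis nonzero_mult_div_cancel_left)
  qed
  ultimately show ?thesis by simp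
qed

text \<open>Every base in the series of \<open>zeta s - 1\<close> is at least \<open>2\<close>, so raising the exponent by \<open>i\<close> gains a factor
  \<open>2 ^ i\<close>.\<close>

lemma zeta_minus_1_le:
  "zeta (real (i + 2)) - 1 \<le> (zeta 2 - 1) * (1 / 2) ^ i"
proof -
  let ?f = "\<lambda>s k. 1 / real (Suc k) powr s"
  have split: "zeta s - 1 = (\<Sum>k. ?f s (Suc k))" if "s > 1" for s
    using suminf_split_head[OF zeta_summable[OF that]] by (simp add: zeta_def)
  have sm: "summable (\<lambda>k. ?f s (Suc k))" if "s > 1" for s
    using zeta_summable[OF that] by (subst summable_Suc_iff)
  have "zeta (real (i + 2)) - 1 = (\<Sum>k. ?f (real (i + 2)) (Suc k))" by (rule split) simp
  also have "\<dots> \<le> (\<Sum>k. (1 / 2) ^ i * ?f 2 (Suc k))"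
  proof (rule suminf_le)
    fix k
    define x where "x = real (Suc (Suc k))"
    have x: "x \<ge> 2" by (simp add: x_def)
    have "1 / x powr real (i + 2) = 1 / (x ^ i * x ^ 2)"
      using x by (subst powr_realpow) (auto simp: power_add power2_eq_square)
    also have "\<dots> \<le> 1 / (2 ^ i * x ^ 2)"
      using x by (intro divide_left_mono mult_right_mono power_mono) auto
    also have "\<dots> = (1 / 2) ^ i * (1 / x powr 2)"
      using x by (simp add: power_one_over)
    finally show "?f (real (i + 2)) (Suc k) \<le> (1 / 2) ^ i * ?f 2 (Suc k)"
      unfolding x_def .
  next
    show "summable (\<lambda>k. ?f (real (i + 2)) (Suc k))" by (rule sm) simp
    show "summable (\<lambda>k. (1 / 2) ^ i * ?f 2 (Suc k))" by (rule summable_mult, rule sm) simp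
  qed
  also have "\<dots> = (1 / 2) ^ i * (\<Sum>k. ?f 2 (Suc k))" by (rule suminf_mult, rule sm) simp
  also have "(\<Sum>k. ?f 2 (Suc k)) = zeta 2 - 1" by (rule split[symmetric]) simp
  finally show ?thesis by (simp add: mult_ac)
qed

lemma zeta_tendsto_1: "(\<lambda>i. zeta (real i)) \<longlonglongrightarrow> 1"
proof -
  have "(\<lambda>i. 1 + (zeta 2 - 1) * (1 / 2) ^ i) \<longlonglongrightarrow> 1 + (zeta 2 - 1) * 0"
    by (intro tendsto_intros LIMSEQ_power_zero) auto
  then have u: "(\<lambda>i. 1 + (zeta 2 - 1) * (1 / 2) ^ i) \<longlonglongrightarrow> 1" by simp
  have "(\<lambda>i. zeta (real (i + 2))) \<longlonglongrightarrow> 1"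
  proof (rule tendsto_sandwich[OF _ _ tendsto_const u])
    show "\<forall>\<^sub>F i in sequentially. 1 \<le> zeta (real (i + 2))" by (simp add: zeta_ge_1)
    show "\<forall>\<^sub>F i in sequentially. zeta (real (i + 2)) \<le> 1 + (zeta 2 - 1) * (1 / 2) ^ i"
      using zeta_minus_1_le by (simp add: algebra_simps)
  qed
  then show ?thesis by (rule LIMSEQ_offset)
qed

lemma zeta_convergent_prod:
  assumes "d > 0"
  shows "convergent_prod (\<lambda>i. zeta (real (d + 1 + i)))"
proof -
  have "summable (\<lambda>i. norm (zeta (real (i + 2)) - 1))"
  proof (rule summable_comparison_test'[of "\<lambda>i. (zeta 2 - 1) * (1 / 2) ^ i" 0])
    show "summable (\<lambda>i. (zeta 2 - 1) * (1 / 2) ^ i)" by (intro summable_mult summable_geometric) simp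
    show "norm (norm (zeta (real (i + 2)) - 1)) \<le> (zeta 2 - 1) * (1 / 2) ^ i" if "i \<ge> 0" for i
      using zeta_ge_1[of "real (i + 2)"] zeta_minus_1_le[of i] by simp
  qed
  then have "summable (\<lambda>i. norm (zeta (real ((i + (d - 1)) + 2)) - 1))"
    by (rule summable_ignore_initial_segment)
  moreover have "real ((i + (d - 1)) + 2) = real (d + 1 + i)" for i using assms by simp
  ultimately have "summable (\<lambda>i. norm (zeta (real (d + 1 + i)) - 1))" by (simp only:)
  then show ?thesis
    by (intro abs_convergent_prod_imp_convergent_prod summable_imp_abs_convergent_prod)
qed

lemma zeta_prod_shift_tendsto_1:
  "(\<lambda>n. \<Prod>i = n - m + 1..n. zeta (real i)) \<longlonglongrightarrow> 1"
proof -
  have "(\<lambda>n. \<Prod>j<m. zeta (real (n - j))) \<longlonglongrightarrow> (\<Prod>j<m. 1)"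
  proof (intro tendsto_prod)
    fix j
    have "(\<lambda>n. zeta (real (n + j - j))) \<longlonglongrightarrow> 1" using zeta_tendsto_1 by simp
    then show "(\<lambda>n. zeta (real (n - j))) \<longlonglongrightarrow> 1" by (rule LIMSEQ_offset)
  qed
  moreover have "\<forall>\<^sub>F n in sequentially.
      (\<Prod>j<m. zeta (real (n - j))) = (\<Prod>i = n - m + 1..n. zeta (real i))"
    using eventually_ge_at_top[of m]
  proof eventually_elim
    case (elim n)
    show ?case
      by (rule prod.reindex_bij_witness[of _ "\<lambda>i. n - i" "\<lambda>j. n - j"]) (use elim in auto)
  qed
  ultimately show ?thesis by (simp add: tendsto_cong)
qed

lemma zeta_prod_tendsto_prodinf:
  assumes "d > 0"
  shows "(\<lambda>n. 1 / (\<Prod>i = n - (n - d) + 1..n. zeta (real i)))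
    \<longlonglongrightarrow> 1 / (\<Prod>i. zeta (real (d + 1 + i)))"
proof -
  let ?f = "\<lambda>i. zeta (real (d + 1 + i))"
  have c: "convergent_prod ?f" using zeta_convergent_prod[OF assms] .
  have "?f i \<noteq> 0" for i using zeta_ge_1[of "real (d + 1 + i)"] assms by simp
  then have nz: "prodinf ?f \<noteq> 0" using c by (simp add: prodinf_nonzero)
  have "(\<lambda>n. \<Prod>i\<le>n. ?f i) \<longlonglongrightarrow> prodinf ?f" using c by (rule convergent_prod_LIMSEQ)
  then have lim: "(\<lambda>n. 1 / (\<Prod>i\<le>n. ?f i)) \<longlonglongrightarrow> 1 / prodinf ?f"
    using nz by (intro tendsto_divide) auto
  have "(\<Prod>i\<le>n. ?f i) = (\<Prod>i = (n + (d + 1)) - ((n + (d + 1)) - d) + 1..n + (d + 1). zeta (real i))" for n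
    by (rule prod.reindex_bij_witness[of _ "\<lambda>i. i - (d + 1)" "\<lambda>i. d + 1 + i"]) auto
  with lim have "(\<lambda>n. 1 / (\<Prod>i = (n + (d + 1)) - ((n + (d + 1)) - d) + 1..n + (d + 1). zeta (real i)))
     \<longlonglongrightarrow> 1 / prodinf ?f" by simp
  then show ?thesis by (rule LIMSEQ_offset)
qed

section \<open>The density of matrices of full rank modulo every prime\<close>

abbreviation full_rank_prob :: "nat \<Rightarrow> nat \<Rightarrow> nat \<Rightarrow> real" where
  "full_rank_prob n m k \<equiv> measure_pmf.prob (iid ({..<n} \<times> {..<m}) (unif_box k))
     {A. \<forall>p. prime p \<longrightarrow> \<not> rank_deficient p n m A}"

lemma snf_prob_eq_full_rank_prob:
  assumes "m < n"
  shows "snf_prob n m k {diag_ones n m} = full_rank_prob n m k"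
  unfolding snf_prob_def random_int_mat_def
  by (simp add: vimage_def smith_diag_ones_iff[OF assms])

lemma full_rank_prob_le:
  "full_rank_prob n m k \<le> measure_pmf.prob (iid ({..<n} \<times> {..<m}) (unif_box k))
     {A. \<forall>p\<in>{p. prime p \<and> p \<le> B}. \<not> rank_deficient p n m A}"
  by (intro measure_pmf.finite_measure_mono) auto

text \<open>Full rank modulo all primes up to \<open>B\<close> fails to imply full rank modulo all primes only through a
  prime beyond \<open>B\<close>, and such a deficiency persists in the first \<open>Suc m\<close> rows.\<close>

lemma full_rank_prob_ge:
  assumes mn: "m < n" and B: "B0 \<le> B"
  shows "measure_pmf.prob (iid ({..<n} \<times> {..<m}) (unif_box k))
     {A. \<forall>p\<in>{p. prime p \<and> p \<le> B}. \<not> rank_deficient p n m A} \<le>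
   full_rank_prob n m k + measure_pmf.prob (iid ({..<Suc m} \<times> {..<m}) (unif_box k))
     {A. \<exists>p>B0. prime p \<and> rank_deficient p (Suc m) m A}"
proof -
  let ?\<mu> = "measure_pmf.prob (iid ({..<n} \<times> {..<m}) (unif_box k))"
  let ?T = "{A. \<exists>p>B0. prime p \<and> rank_deficient p (Suc m) m A}"
  have "?\<mu> {A. \<forall>p\<in>{p. prime p \<and> p \<le> B}. \<not> rank_deficient p n m A} \<le>
      ?\<mu> ({A. \<forall>p. prime p \<longrightarrow> \<not> rank_deficient p n m A} \<union> ?T)"
  proof (intro measure_pmf.finite_measure_mono subsetI)
    fix A assume A: "A \<in> {A. \<forall>p\<in>{p. prime p \<and> p \<le> B}. \<not> rank_deficient p n m A}"
    show "A \<in> {A. \<forall>p. prime p \<longrightarrow> \<not> rank_deficient p n m A} \<union> ?T"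
    proof (cases "\<forall>p. prime p \<longrightarrow> \<not> rank_deficient p n m A")
      case False
      then obtain p where p: "prime p" "rank_deficient p n m A" by blast
      with A have "\<not> p \<le> B" by blast
      then have "p > B0" using B by simp
      moreover have "rank_deficient p (Suc m) m A"
        using rank_deficient_fewer_rows[OF p(2), of "Suc m"] mn by simp
      ultimately show ?thesis using p by blast
    qed simp
  qed simp
  also have "\<dots> \<le> full_rank_prob n m k + ?\<mu> ?T" by (rule measure_Un_le) auto
  also have "?\<mu> ?T = measure_pmf.prob (iid ({..<Suc m} \<times> {..<m}) (unif_box k)) ?T"
  proof (rule prob_iid_subset)
    show "{..<Suc m} \<times> {..<m} \<subseteq> {..<n} \<times> {..<m}" using mn by auto
    fix A A' :: "nat \<times> nat \<Rightarrow> int"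
    assume "\<And>x. x \<in> {..<Suc m} \<times> {..<m} \<Longrightarrow> A x = A' x"
    then have "rank_deficient p (Suc m) m A = rank_deficient p (Suc m) m A'" for p
      by (intro rank_deficient_cong) auto
    then show "(\<exists>p>B0. prime p \<and> rank_deficient p (Suc m) m A) =
        (\<exists>p>B0. prime p \<and> rank_deficient p (Suc m) m A')" by simp
  qed simp
  finally show ?thesis .
qed

text \<open>With \<open>i = n - j\<close> the local factors are those of Euler's product at the integers \<open>n - m + 1, ..., n\<close>.\<close>

lemma local_densities_tendsto:
  assumes "m < n"
  shows "(\<lambda>B. \<Prod>p | prime p \<and> p \<le> B. \<Prod>j<m. 1 - real p ^ j / real p ^ n)
    \<longlonglongrightarrow> 1 / (\<Prod>i = n - m + 1..n. zeta (real i))"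
proof -
  have eq: "(\<Prod>j<m. 1 - real p ^ j / real p ^ n) = (\<Prod>i = n - m + 1..n. 1 - 1 / real p powr real i)"
    if "prime p" for p :: nat
  proof (rule prod.reindex_bij_witness[of _ "\<lambda>i. n - i" "\<lambda>j. n - j"])
    fix j assume j: "j \<in> {..<m}"
    have p: "real p > 0" using that by (simp add: prime_gt_0_nat)
    have "real p ^ n = real p ^ j * real p ^ (n - j)"
      using j assms by (simp add: power_add[symmetric])
    then show "1 - 1 / real p powr real (n - j) = 1 - real p ^ j / real p ^ n"
      using p by (simp only: powr_realpow) (simp add: field_simps)
  qed (use assms in auto)
  have "(\<lambda>B. \<Prod>i = n - m + 1..n. \<Prod>p | prime p \<and> p \<le> B. 1 - 1 / real p powr real i)
      \<longlonglongrightarrow> (\<Prod>i = n - m + 1..n. 1 / zeta (real i))"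
    using assms by (intro tendsto_prod euler_product) auto
  also have "(\<Prod>i = n - m + 1..n. 1 / zeta (real i)) = 1 / (\<Prod>i = n - m + 1..n. zeta (real i))"
    by (simp add: prod_dividef)
  also have "(\<lambda>B. \<Prod>i = n - m + 1..n. \<Prod>p | prime p \<and> p \<le> B. 1 - 1 / real p powr real i) =
      (\<lambda>B. \<Prod>p | prime p \<and> p \<le> B. \<Prod>j<m. 1 - real p ^ j / real p ^ n)"
  proof
    fix B
    have "(\<Prod>i = n - m + 1..n. \<Prod>p | prime p \<and> p \<le> B. 1 - 1 / real p powr real i) =
        (\<Prod>p | prime p \<and> p \<le> B. \<Prod>i = n - m + 1..n. 1 - 1 / real p powr real i)"
      by (rule prod.swap)
    also have "\<dots> = (\<Prod>p | prime p \<and> p \<le> B. \<Prod>j<m. 1 - real p ^ j / real p ^ n)"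
      by (rule prod.cong[OF refl]) (simp only: mem_Collect_eq eq)
    finally show "(\<Prod>i = n - m + 1..n. \<Prod>p | prime p \<and> p \<le> B. 1 - 1 / real p powr real i) =
        (\<Prod>p | prime p \<and> p \<le> B. \<Prod>j<m. 1 - real p ^ j / real p ^ n)" .
  qed
  finally show ?thesis .
qed

text \<open>The bound \<open>B\<close> is chosen first, making both the large primes negligible and the partial Euler
  products close to their limit; only then does \<open>k\<close> tend to infinity.\<close>

lemma full_rank_prob_tendsto:
  assumes mn: "m < n"
  shows "(\<lambda>k. full_rank_prob n m k) \<longlonglongrightarrow> 1 / (\<Prod>i = n - m + 1..n. zeta (real i))"
proof (rule LIMSEQ_I)
  fix e :: real assume e: "e > 0"
  let ?L = "1 / (\<Prod>i = n - m + 1..n. zeta (real i))"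
  let ?P = "\<lambda>B. {p::nat. prime p \<and> p \<le> B}"
  let ?Q = "\<lambda>B. \<Prod>p\<in>?P B. \<Prod>j<m. 1 - real p ^ j / real p ^ n"
  let ?q = "\<lambda>B k. measure_pmf.prob (iid ({..<n} \<times> {..<m}) (unif_box k)) {A. \<forall>p\<in>?P B. \<not> rank_deficient p n m A}"
  obtain B0 where B0: "\<forall>\<^sub>F k in sequentially. measure_pmf.prob (iid ({..<Suc m} \<times> {..<m}) (unif_box k))
      {A. \<exists>p>B0. prime p \<and> rank_deficient p (Suc m) m A} \<le> e / 4"
    using large_primes_negligible[of "e / 4" m] e by auto
  have "\<forall>\<^sub>F B in sequentially. dist (?Q B) ?L < e / 4"
    using tendstoD[OF local_densities_tendsto[OF mn], of "e / 4"] e by simp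
  then have "\<forall>\<^sub>F B in sequentially. dist (?Q B) ?L < e / 4 \<and> B0 \<le> B"
    using eventually_ge_at_top[of B0] by (rule eventually_conj)
  then obtain B where B: "dist (?Q B) ?L < e / 4" "B0 \<le> B"
    by (auto dest: eventually_happens)
  have "(\<lambda>k. ?q B k) \<longlonglongrightarrow> ?Q B"
    by (rule prob_full_rank_finite_primes_tendsto) auto
  then have "\<forall>\<^sub>F k in sequentially. dist (?q B k) (?Q B) < e / 4"
    using e by (intro tendstoD) auto
  with B0 have "\<forall>\<^sub>F k in sequentially. norm (full_rank_prob n m k - ?L) < e"
  proof eventually_elim
    case (elim k)
    show ?case
      using elim B full_rank_prob_le[of n m k B] full_rank_prob_ge[OF mn B(2), of k] e
      unfolding dist_real_def real_norm_def by linarith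
  qed
  then show "\<exists>k0. \<forall>k\<ge>k0. norm (full_rank_prob n m k - ?L) < e"
    by (simp add: eventually_sequentially)
qed

theorem theorem4p8:
  shows "(\<forall>m n :: nat. 0 < m \<longrightarrow> m < n \<longrightarrow>
            convergent (\<lambda>k. snf_prob n m k {diag_ones n m}) \<and>
            snf_density n m {diag_ones n m} = 1 / (\<Prod>i = n - m + 1..n. zeta (real i))) \<and>
         (\<forall>m :: nat. 0 < m \<longrightarrow>
            (\<lambda>n. snf_density n m {diag_ones n m}) \<longlonglongrightarrow> 1) \<and>
         (\<forall>d :: nat. 0 < d \<longrightarrow>
            convergent_prod (\<lambda>i. zeta (real (d + 1 + i))) \<and>
            (\<lambda>n. snf_density n (n - d) {diag_ones n (n - d)})
               \<longlonglongrightarrow> 1 / (\<Prod>i. zeta (real (d + 1 + i))))"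
proof (intro conjI allI impI)
  have lim: "(\<lambda>k. snf_prob n m k {diag_ones n m}) \<longlonglongrightarrow> 1 / (\<Prod>i = n - m + 1..n. zeta (real i))"
    if "m < n" for m n :: nat
    using full_rank_prob_tendsto[OF that] by (simp add: snf_prob_eq_full_rank_prob[OF that])
  show "convergent (\<lambda>k. snf_prob n m k {diag_ones n m})" if "0 < m" "m < n" for m n :: nat
    using lim[OF that(2)] by (rule convergentI)
  have density: "snf_density n m {diag_ones n m} = 1 / (\<Prod>i = n - m + 1..n. zeta (real i))"
    if "m < n" for m n :: nat
    unfolding snf_density_def using lim[OF that] by (rule limI)
  then show "snf_density n m {diag_ones n m} = 1 / (\<Prod>i = n - m + 1..n. zeta (real i))"
    if "0 < m" "m < n" for m n :: nat using that by blast
  show "(\<lambda>n. snf_density n m {diag_ones n m}) \<longlonglongrightarrow> 1" if "0 < m" for m :: nat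
  proof (rule Lim_transform_eventually)
    show "(\<lambda>n. 1 / (\<Prod>i = n - m + 1..n. zeta (real i))) \<longlonglongrightarrow> 1"
      using tendsto_divide[OF tendsto_const[of 1] zeta_prod_shift_tendsto_1[of m]] by simp
    show "\<forall>\<^sub>F n in sequentially. 1 / (\<Prod>i = n - m + 1..n. zeta (real i)) = snf_density n m {diag_ones n m}"
      using eventually_gt_at_top[of m] by eventually_elim (simp only: density)
  qed
  fix d :: nat assume d: "0 < d"
  show "convergent_prod (\<lambda>i. zeta (real (d + 1 + i)))" using d by (rule zeta_convergent_prod)
  show "(\<lambda>n. snf_density n (n - d) {diag_ones n (n - d)}) \<longlonglongrightarrow> 1 / (\<Prod>i. zeta (real (d + 1 + i)))"
  proof (rule Lim_transform_eventually[OF zeta_prod_tendsto_prodinf[OF d]])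
    show "\<forall>\<^sub>F n in sequentially.
        1 / (\<Prod>i = n - (n - d) + 1..n. zeta (real i)) = snf_density n (n - d) {diag_ones n (n - d)}"
      using eventually_gt_at_top[of d]
    proof eventually_elim
      case (elim n)
      then have "n - d < n" using d by simp
      then show ?case by (rule density[symmetric])
    qed
  qed
qed

end
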